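(* Up to projective equivalence, there are exactly eight Rédei blocking sets of index 3 and size 14 in $PG(2,7)$.
   Context: A (proper) blocking set in $PG(2,q)$ is a set $S$ of points meeting every line and containing no line. It is minimal if it does not properly contain a smaller blocking set. The index of $S$ is the minimum number of lines whose union contains $S$. A Rédei blocking set is a minimal blocking set with $q+n$ points for which the maximum number of its points on a line is $n$. Two blocking sets are projectively equivalent if some collineation of the plane maps one onto the other. *)

theory Defs
  imports "HOL-Analysis.Cartesian_Space"
begin

(* PG(2,q) over the finite field 'f with q = CARD('f): points are the one-dimensional
   subspaces of 'f^3.  A line is identified with the set of points on it. *)

definition pg_points :: "('f::{field,finite} ^ 3) set set" where
  "pg_points = {P. vec.subspace P \<and> vec.dim P = 1}"

definition pg_lines :: "('f::{field,finite} ^ 3) set set set" where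
  "pg_lines = {{P \<in> pg_points. P \<subseteq> W} |W. vec.subspace W \<and> vec.dim W = 2}"

definition blocking_set :: "('f::{field,finite} ^ 3) set set \<Rightarrow> bool" where
  "blocking_set S \<longleftrightarrow>
     S \<subseteq> pg_points \<and> (\<forall>L\<in>pg_lines. S \<inter> L \<noteq> {} \<and> \<not> L \<subseteq> S)"

definition minimal_blocking_set :: "('f::{field,finite} ^ 3) set set \<Rightarrow> bool" where
  "minimal_blocking_set S \<longleftrightarrow> blocking_set S \<and> (\<forall>T. T \<subset> S \<longrightarrow> \<not> blocking_set T)"

definition blocking_index :: "('f::{field,finite} ^ 3) set set \<Rightarrow> nat" where
  "blocking_index S = (LEAST k. \<exists>M. M \<subseteq> pg_lines \<and> card M = k \<and> S \<subseteq> \<Union>M)"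

definition redei_blocking_set :: "('f::{field,finite} ^ 3) set set \<Rightarrow> bool" where
  "redei_blocking_set S \<longleftrightarrow> minimal_blocking_set S \<and>
     (\<exists>n. card S = CARD('f) + n \<and> Max ((\<lambda>L. card (S \<inter> L)) ` pg_lines) = n)"

(* Arbitrary collineations, not only those induced by linear maps.  Values of h outside
   the point set are irrelevant. *)

definition collineation ::
  "(('f::{field,finite} ^ 3) set \<Rightarrow> ('f ^ 3) set) \<Rightarrow> bool" where
  "collineation h \<longleftrightarrow> bij_betw h pg_points pg_points \<and> (\<lambda>L. h ` L) ` pg_lines = pg_lines"

definition projectively_equivalent ::
  "(('f::{field,finite} ^ 3) set set \<times> ('f ^ 3) set set) set" where
  "projectively_equivalent =
     {(S, T). S \<subseteq> pg_points \<and> T \<subseteq> pg_points \<and> (\<exists>h. collineation h \<and> h ` S = T)}"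

lemma equiv_projectively_equivalent:
  "equiv (Pow pg_points) (projectively_equivalent :: (('f::{field,finite} ^ 3) set set \<times> _) set)"
proof (rule equivI)
  show "projectively_equivalent \<subseteq> Pow pg_points \<times> Pow (pg_points :: ('f ^ 3) set set)"
    by (auto simp: projectively_equivalent_def)
  have "collineation (id :: ('f ^ 3) set \<Rightarrow> _)"
    by (simp add: collineation_def)
  then have "\<exists>h. collineation h \<and> h ` S = S" for S :: "('f ^ 3) set set"
    by (metis image_id id_apply)
  then show "refl_on (Pow (pg_points :: ('f ^ 3) set set)) projectively_equivalent"
    by (auto simp: refl_on_def projectively_equivalent_def)
  show "sym (projectively_equivalent :: (('f ^ 3) set set \<times> _) set)"
  proof (rule symI)
    fix S T :: "('f ^ 3) set set"
    assume "(S, T) \<in> projectively_equivalent"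
    then obtain h where ST: "S \<subseteq> pg_points" "T \<subseteq> pg_points" "h ` S = T"
      and h: "bij_betw h pg_points pg_points" "(\<lambda>L. h ` L) ` pg_lines = pg_lines"
      by (auto simp: projectively_equivalent_def collineation_def)
    let ?g = "inv_into pg_points h"
    have gh: "?g ` h ` A = A" if "A \<subseteq> pg_points" for A
      using that h(1) by (metis bij_betw_def inv_into_image_cancel)
    have "L \<subseteq> pg_points" if "L \<in> pg_lines" for L :: "('f ^ 3) set set"
      using that by (auto simp: pg_lines_def)
    then have "(\<lambda>L. ?g ` h ` L) ` pg_lines = pg_lines"
      using gh by simp
    then have "(\<lambda>L. ?g ` L) ` pg_lines = pg_lines"
      by (metis h(2) image_image)
    then have "collineation ?g"
      using h(1) by (simp add: collineation_def bij_betw_inv_into)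
    then show "(T, S) \<in> projectively_equivalent"
      using ST gh[OF ST(1)] unfolding projectively_equivalent_def by blast
  qed
  show "trans (projectively_equivalent :: (('f ^ 3) set set \<times> _) set)"
  proof (rule transI)
    fix S T U :: "('f ^ 3) set set"
    assume "(S, T) \<in> projectively_equivalent" "(T, U) \<in> projectively_equivalent"
    then obtain h g where hg: "collineation h" "collineation g" "h ` S = T" "g ` T = U"
      and "S \<subseteq> pg_points" "U \<subseteq> pg_points"
      by (auto simp: projectively_equivalent_def)
    have "(\<lambda>L. (g \<circ> h) ` L) ` pg_lines = (\<lambda>L. g ` L) ` (\<lambda>L. h ` L) ` pg_lines"
      by (simp add: image_image image_comp)
    then have "collineation (g \<circ> h)"
      using hg(1,2) by (auto simp: collineation_def intro: bij_betw_trans)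
    then show "(S, U) \<in> projectively_equivalent"
      using hg(3,4) \<open>S \<subseteq> pg_points\<close> \<open>U \<subseteq> pg_points\<close>
      by (auto simp: projectively_equivalent_def image_comp intro!: exI[of _ "g \<circ> h"])
  qed
qed

end

theory Submission
  imports Defs
begin

text \<open>
  Let \<open>S\<close> be in the family.  It has seven points on some line, whose eighth point \<open>N\<close> is not in \<open>S\<close>.
  A collineation moves this line to infinity and \<open>N\<close> to the vertical direction.  The remaining seven
  points then lie one on each vertical line, so they form the graph of a function \<open>f\<close>.  Minimality of
  \<open>S\<close> means that \<open>f\<close> determines all seven non-vertical directions.  A cover of \<open>S\<close> by three lines
  must use the line at infinity, so index 3 means that the graph is covered by two lines, which
  may be taken non-vertical (\<open>redei_index3_normal_form\<close>).  Conversely, every function that determines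
  all directions and has its graph on two lines gives a member of the family
  (\<open>graph_set_mem_redei_index3\<close>).

  An affine map turns the two lines into \<open>y = 0\<close> and \<open>y = 1\<close>, or into \<open>y = 0\<close> and \<open>y = x\<close>
  (\<open>two_line_cover_normal_form\<close>), so \<open>f\<close> is given by the set \<open>A\<close> of arguments with value \<open>0\<close>.  In the
  parallel case \<open>A\<close> matters only up to affine maps of the field and complement, and must be a
  nonempty proper subset; this leaves \<open>{0}\<close>, \<open>{0, 1}\<close>, \<open>{0, 1, 3}\<close> and \<open>{0, 1, 6}\<close>.  In the intersecting
  case \<open>A\<close>, with \<open>0\<close> disregarded, is a subset of the cyclic multiplicative group of order 6 up to multiplication and
  complement, and it must not be a union of cosets of a nontrivial subgroup; this leaves \<open>{1}\<close>,
  which reduces to the parallel case, and \<open>{1, 2}\<close>, \<open>{1, 3}\<close>, \<open>{1, 2, 3}\<close> and \<open>{1, 3, 6}\<close>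
  (\<open>redei_index3_represented\<close>).

  The eight resulting sets are pairwise inequivalent, because an invariant of the configuration of
  their three-secants separates them (\<open>profile_equivalent\<close>, \<open>representatives_profiles\<close>): the number of
  three-secants, together with the number of points of \<open>S\<close> on those three-secants that contain a point
  of \<open>S\<close> on no other three-secant.  Counting secants alone would not do: the sets from \<open>{1, 2}\<close> and \<open>{1, 3}\<close>
  have, for each point of the plane, the same numbers of secants of each size through it, up to a
  permutation of the points.
\<close>

section \<open>Affine coordinates on the projective plane\<close>

text \<open>Homogeneous coordinates \<open>(x, y, z)\<close> with the line \<open>z = 0\<close> as line at infinity: \<open>aff x y\<close> is the
  affine point \<open>(x, y)\<close>, \<open>dir m\<close> the point at infinity of the lines of slope \<open>m\<close>, and \<open>vert\<close> the
  point at infinity of the vertical lines.\<close>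

definition aff :: "'f::{field,finite} \<Rightarrow> 'f \<Rightarrow> ('f ^ 3) set" where
  "aff x y = vec.span {vector [x, y, 1]}"

definition dir :: "'f::{field,finite} \<Rightarrow> ('f ^ 3) set" where
  "dir m = vec.span {vector [1, m, 0]}"

definition vert :: "('f::{field,finite} ^ 3) set" where
  "vert = vec.span {vector [0, 1, 0]}"

text \<open>The three kinds of lines: \<open>y = m x + b\<close>, \<open>x = c\<close>, and the line at infinity.\<close>

definition slanted :: "'f::{field,finite} \<Rightarrow> 'f \<Rightarrow> ('f ^ 3) set set" where
  "slanted m b = insert (dir m) (range (\<lambda>x. aff x (m * x + b)))"

definition vertical :: "'f::{field,finite} \<Rightarrow> ('f ^ 3) set set" where
  "vertical c = insert vert (range (aff c))"

definition infinity :: "('f::{field,finite} ^ 3) set set" where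
  "infinity = insert vert (range dir)"

lemma vec3_eq_iff: "(u :: 'a ^ 3) = v \<longleftrightarrow> u $ 1 = v $ 1 \<and> u $ 2 = v $ 2 \<and> u $ 3 = v $ 3"
  by (simp add: vec_eq_iff forall_3)

lemma span_scale_eq:
  fixes v :: "'f::field ^ 'n"
  assumes "c \<noteq> 0" "u = c *s v"
  shows "vec.span {u} = vec.span {v}"
proof -
  have "v = inverse c *s u"
    using assms by (simp add: vector_smult_assoc)
  moreover have "u \<in> vec.span {v}"
    unfolding vec.span_singleton using assms by blast
  ultimately show ?thesis
    unfolding vec.span_eq using assms(2) by (auto simp: vec.span_singleton)
qed

lemma span_singleton_eq_iff:
  fixes u v :: "'f::field ^ 'n"
  assumes "u \<noteq> 0"
  shows "vec.span {u} = vec.span {v} \<longleftrightarrow> (\<exists>c. c \<noteq> 0 \<and> u = c *s v)"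
proof
  assume "vec.span {u} = vec.span {v}"
  then have "u \<in> vec.span {v}"
    using vec.span_base by blast
  then obtain c where "u = c *s v"
    by (auto simp: vec.span_singleton)
  with assms show "\<exists>c. c \<noteq> 0 \<and> u = c *s v"
    by (metis vec.scale_zero_left)
qed (use span_scale_eq in blast)

lemma coordinate_points_distinct [simp]:
  "aff x y = aff x' y' \<longleftrightarrow> x = x' \<and> y = y'"
  "dir m = dir m' \<longleftrightarrow> m = m'"
  "aff x y \<noteq> dir m" "dir m \<noteq> aff x y"
  "aff x y \<noteq> vert" "vert \<noteq> aff x y"
  "dir m \<noteq> vert" "vert \<noteq> dir m"
  by (auto simp: aff_def dir_def vert_def span_singleton_eq_iff vec3_eq_iff)

lemma mem_pg_points_iff: "P \<in> pg_points \<longleftrightarrow> (\<exists>v. v \<noteq> 0 \<and> P = vec.span {v})"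
proof
  assume P: "P \<in> pg_points"
  obtain B where B: "B \<subseteq> P" "vec.independent B" "P \<subseteq> vec.span B" "card B = vec.dim P"
    using vec.basis_exists by blast
  then obtain v where "B = {v}"
    using P by (auto simp: pg_points_def card_1_singleton_iff)
  then have "v \<noteq> 0" "P = vec.span {v}"
    using B P vec.span_subspace[of B P] by (auto simp: pg_points_def)
  then show "\<exists>v. v \<noteq> 0 \<and> P = vec.span {v}"
    by blast
qed (auto simp: pg_points_def)

theorem pg_points_eq:
  "pg_points = (range (case_prod aff) \<union> range dir \<union> {vert} :: ('f::{field,finite} ^ 3) set set)"
proof (intro equalityI subsetI)
  fix P :: "('f ^ 3) set"
  assume "P \<in> pg_points"
  then obtain v where v: "v \<noteq> 0" "P = vec.span {v}"
    by (auto simp: mem_pg_points_iff)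
  consider "v $ 3 \<noteq> 0" | "v $ 3 = 0" "v $ 1 \<noteq> 0" | "v $ 3 = 0" "v $ 1 = 0" "v $ 2 \<noteq> 0"
    using v(1) by (auto simp: vec3_eq_iff)
  then show "P \<in> range (case_prod aff) \<union> range dir \<union> {vert}"
  proof cases
    case 1
    then have "P = aff (v $ 1 / v $ 3) (v $ 2 / v $ 3)"
      unfolding v(2) aff_def by (intro span_scale_eq[of "v $ 3"]) (auto simp: vec3_eq_iff)
    then show ?thesis by auto
  next
    case 2
    then have "P = dir (v $ 2 / v $ 1)"
      unfolding v(2) dir_def by (intro span_scale_eq[of "v $ 1"]) (auto simp: vec3_eq_iff)
    then show ?thesis by auto
  next
    case 3
    then have "P = vert"
      unfolding v(2) vert_def by (intro span_scale_eq[of "v $ 2"]) (auto simp: vec3_eq_iff)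
    then show ?thesis by auto
  qed
next
  fix P :: "('f ^ 3) set"
  assume "P \<in> range (case_prod aff) \<union> range dir \<union> {vert}"
  then show "P \<in> pg_points"
    unfolding aff_def dir_def vert_def
    by (auto simp: pg_points_def vec3_eq_iff)
qed

lemma coordinate_points_mem [simp]: "aff x y \<in> pg_points" "dir m \<in> pg_points" "vert \<in> pg_points"
  by (auto simp: pg_points_eq)

text \<open>The kernel of a linear functional, in coordinates; for a nonzero functional it is a
  two-dimensional subspace, and every two-dimensional subspace is of this form.\<close>

definition null_plane :: "'f::{field,finite} \<Rightarrow> 'f \<Rightarrow> 'f \<Rightarrow> ('f ^ 3) set" where
  "null_plane a b c = {v. a * v $ 1 + b * v $ 2 + c * v $ 3 = 0}"

lemma subspace_null_plane: "vec.subspace (null_plane a b c)"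
  unfolding vec.subspace_def
proof (intro conjI allI ballI)
  fix k u v
  assume u: "u \<in> null_plane a b c"
  have "a * (k * u $ 1) + b * (k * u $ 2) + c * (k * u $ 3) = k * (a * u $ 1 + b * u $ 2 + c * u $ 3)"
    by (simp add: algebra_simps)
  with u show "k *s u \<in> null_plane a b c"
    by (simp add: null_plane_def)
  assume v: "v \<in> null_plane a b c"
  have "a * (u $ 1 + v $ 1) + b * (u $ 2 + v $ 2) + c * (u $ 3 + v $ 3)
      = (a * u $ 1 + b * u $ 2 + c * u $ 3) + (a * v $ 1 + b * v $ 2 + c * v $ 3)"
    by (simp add: algebra_simps)
  with u v show "u + v \<in> null_plane a b c"
    by (simp add: null_plane_def)
qed (simp add: null_plane_def)

lemma dim_null_plane:
  assumes "a \<noteq> 0 \<or> b \<noteq> 0 \<or> c \<noteq> 0"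
  shows "vec.dim (null_plane a b c) = 2"
proof (rule antisym)
  have "null_plane a b c \<noteq> UNIV"
  proof
    assume "null_plane a b c = UNIV"
    then have "vector [1,0,0] \<in> null_plane a b c" "vector [0,1,0] \<in> null_plane a b c" "vector [0,0,1] \<in> null_plane a b c"
      by auto
    with assms show False
      by (auto simp: null_plane_def)
  qed
  then have "vec.dim (null_plane a b c) < vec.dim (UNIV :: ('a ^ 3) set)"
    by (intro vec.dim_psubset) (auto simp: vec.span_eq_iff[THEN iffD2, OF subspace_null_plane])
  then show "vec.dim (null_plane a b c) \<le> 2"
    unfolding vec_dim_card by simp
  obtain u v where uv: "u \<in> null_plane a b c" "v \<in> null_plane a b c" "u \<notin> vec.span {v}" "v \<noteq> 0"
  proof -
    consider "a \<noteq> 0" | "a = 0" "b \<noteq> 0" | "a = 0" "b = 0" "c \<noteq> 0"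
      using assms by blast
    then show ?thesis
    proof cases
      case 1
      then show ?thesis
        by (intro that[of "vector [-b, a, 0]" "vector [-c, 0, a]"])
          (auto simp: null_plane_def vec.span_singleton vec3_eq_iff)
    next
      case 2
      then show ?thesis
        by (intro that[of "vector [1, 0, 0]" "vector [0, -c, b]"])
          (auto simp: null_plane_def vec.span_singleton vec3_eq_iff)
    next
      case 3
      then show ?thesis
        by (intro that[of "vector [1, 0, 0]" "vector [0, 1, 0]"])
          (auto simp: null_plane_def vec.span_singleton vec3_eq_iff)
    qed
  qed
  have "vec.dim {u, v} = 2"
    using uv by (simp add: vec.dim_insert)
  moreover have "vec.dim {u, v} \<le> vec.dim (null_plane a b c)"
    using uv by (intro vec.dim_subset) auto
  ultimately show "2 \<le> vec.dim (null_plane a b c)"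
    by simp
qed

lemma dim_2_imp_null_plane:
  fixes W :: "('f::{field,finite} ^ 3) set"
  assumes W: "vec.subspace W" "vec.dim W = 2"
  obtains a b c where "a \<noteq> 0 \<or> b \<noteq> 0 \<or> c \<noteq> 0" "W = null_plane a b c"
proof -
  obtain B where B: "B \<subseteq> W" "vec.independent B" "W \<subseteq> vec.span B" "card B = vec.dim W"
    using vec.basis_exists by blast
  then obtain u v where uv: "B = {u, v}" "u \<noteq> v"
    using W by (auto simp: card_2_iff)
  \<comment> \<open>The functional is the cross product of two basis vectors.\<close>
  define a where "a = u $ 2 * v $ 3 - u $ 3 * v $ 2"
  define b where "b = u $ 3 * v $ 1 - u $ 1 * v $ 3"
  define c where "c = u $ 1 * v $ 2 - u $ 2 * v $ 1"
  have nz: "a \<noteq> 0 \<or> b \<noteq> 0 \<or> c \<noteq> 0"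
  proof (rule ccontr)
    assume "\<not> ?thesis"
    then have eq: "u $ 2 * v $ 3 = u $ 3 * v $ 2" "u $ 3 * v $ 1 = u $ 1 * v $ 3" "u $ 1 * v $ 2 = u $ 2 * v $ 1"
      by (auto simp: a_def b_def c_def)
    have "u \<notin> vec.span {v}" "v \<noteq> 0"
      using B(2) uv by (auto simp: vec.independent_insert)
    then obtain i where "v $ i \<noteq> 0"
      by (auto simp: vec_eq_iff)
    then have "u = (u $ i / v $ i) *s v"
      using eq exhaust_3[of i] by (auto simp: vec3_eq_iff field_simps)
    then have "u \<in> vec.span {v}"
      unfolding vec.span_singleton by blast
    then show False
      using \<open>u \<notin> vec.span {v}\<close> by blast
  qed
  have "B \<subseteq> null_plane a b c"
    by (auto simp: uv null_plane_def a_def b_def c_def algebra_simps)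
  then have "vec.span B \<subseteq> null_plane a b c"
    by (simp add: subspace_null_plane vec.span_minimal)
  then have "W \<subseteq> null_plane a b c"
    using B(3) by blast
  then have "W = null_plane a b c"
    using vec.subspace_dim_equal[OF W(1) subspace_null_plane] W(2) dim_null_plane[OF nz] by simp
  with nz that show ?thesis
    by blast
qed

lemma span_singleton_subset_iff: "vec.subspace W \<Longrightarrow> vec.span {v} \<subseteq> W \<longleftrightarrow> v \<in> W"
  by (metis empty_subsetI insert_subset vec.span_minimal vec.span_superset subset_trans)

lemma coordinate_points_subset_null_plane [simp]:
  "aff x y \<subseteq> null_plane a b c \<longleftrightarrow> a * x + b * y + c = 0"
  "dir m \<subseteq> null_plane a b c \<longleftrightarrow> a + b * m = 0"
  "vert \<subseteq> null_plane a b c \<longleftrightarrow> b = 0"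
  unfolding aff_def dir_def vert_def span_singleton_subset_iff[OF subspace_null_plane]
  by (simp_all add: null_plane_def)

lemma coordinate_incidence [simp]:
  "aff x y \<in> slanted m b \<longleftrightarrow> y = m * x + b"
  "dir m' \<in> slanted m b \<longleftrightarrow> m' = m"
  "vert \<notin> slanted m b"
  "aff x y \<in> vertical c \<longleftrightarrow> x = c"
  "dir m' \<notin> vertical c"
  "vert \<in> vertical c"
  "aff x y \<notin> infinity"
  "dir m' \<in> infinity"
  "vert \<in> infinity"
  by (auto simp: slanted_def vertical_def infinity_def)

lemma point_set_eqI:
  assumes "A \<subseteq> pg_points" "B \<subseteq> pg_points"
    and "\<And>x y. aff x y \<in> A \<longleftrightarrow> aff x y \<in> B" "\<And>m. dir m \<in> A \<longleftrightarrow> dir m \<in> B"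
    and "vert \<in> A \<longleftrightarrow> vert \<in> B"
  shows "A = B"
proof (rule set_eqI)
  fix P show "P \<in> A \<longleftrightarrow> P \<in> B"
  proof (cases "P \<in> pg_points")
    case True
    then show ?thesis
      using assms by (auto simp: pg_points_eq)
  qed (use assms in blast)
qed

lemma coordinate_lines_subset:
  "slanted m b \<subseteq> pg_points" "vertical c \<subseteq> pg_points" "infinity \<subseteq> pg_points"
  by (auto simp: slanted_def vertical_def infinity_def)

lemma points_of_null_plane_slanted:
  assumes "b \<noteq> 0"
  shows "{P \<in> pg_points. P \<subseteq> null_plane a b c} = slanted (- a / b) (- c / b)"
  using assms by (intro point_set_eqI coordinate_lines_subset)
    (auto simp: field_simps add_eq_0_iff minus_equation_iff)

lemma points_of_null_plane_vertical:
  assumes "a \<noteq> 0"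
  shows "{P \<in> pg_points. P \<subseteq> null_plane a 0 c} = vertical (- c / a)"
  using assms by (intro point_set_eqI coordinate_lines_subset) (auto simp: field_simps add_eq_0_iff)

lemma points_of_null_plane_infinity:
  assumes "c \<noteq> 0"
  shows "{P \<in> pg_points. P \<subseteq> null_plane 0 0 c} = infinity"
  using assms by (intro point_set_eqI coordinate_lines_subset) auto

theorem pg_lines_eq:
  "pg_lines = (range (case_prod slanted) \<union> range vertical \<union> {infinity} :: ('f::{field,finite} ^ 3) set set set)"
proof (intro equalityI subsetI)
  fix L :: "('f ^ 3) set set"
  assume "L \<in> pg_lines"
  then obtain a b c where abc: "a \<noteq> 0 \<or> b \<noteq> 0 \<or> c \<noteq> 0" "L = {P \<in> pg_points. P \<subseteq> null_plane a b c}"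
  proof -
    obtain W where "vec.subspace W" "vec.dim W = 2" "L = {P \<in> pg_points. P \<subseteq> W}"
      using \<open>L \<in> pg_lines\<close> unfolding pg_lines_def by blast
    with that show ?thesis
      by (auto elim!: dim_2_imp_null_plane)
  qed
  from abc(1) consider "b \<noteq> 0" | "b = 0" "a \<noteq> 0" | "b = 0" "a = 0" "c \<noteq> 0"
    by blast
  then have "(\<exists>m b. L = slanted m b) \<or> (\<exists>c. L = vertical c) \<or> L = infinity"
  proof cases
    case 1
    then have "L = slanted (- a / b) (- c / b)"
      unfolding abc(2) by (rule points_of_null_plane_slanted)
    then show ?thesis
      by blast
  next
    case 2
    then have "L = vertical (- c / a)"
      using abc(2) points_of_null_plane_vertical[OF 2(2)] by (simp only:)
    then show ?thesis
      by blast
  next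
    case 3
    then have "L = infinity"
      using abc(2) points_of_null_plane_infinity[OF 3(3)] by (simp only:)
    then show ?thesis
      by blast
  qed
  then show "L \<in> range (case_prod slanted) \<union> range vertical \<union> {infinity}"
    by (elim disjE exE) auto
next
  have null_plane_line: "{P \<in> pg_points. P \<subseteq> null_plane a b c} \<in> pg_lines"
    if "a \<noteq> 0 \<or> b \<noteq> 0 \<or> c \<noteq> 0" for a b c :: 'f
    unfolding pg_lines_def using dim_null_plane[OF that] subspace_null_plane by blast
  fix L :: "('f ^ 3) set set"
  assume "L \<in> range (case_prod slanted) \<union> range vertical \<union> {infinity}"
  then consider m b where "L = slanted m b" | c where "L = vertical c" | "L = infinity"
    by (elim UnE imageE singletonE) (simp_all only: split_beta)
  then show "L \<in> pg_lines"
  proof cases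
    case 1
    then show ?thesis
      using null_plane_line[of "-m" 1 "-b"] by (simp add: points_of_null_plane_slanted)
  next
    case 2
    then show ?thesis
      using null_plane_line[of 1 0 "-c"] by (simp add: points_of_null_plane_vertical)
  next
    case 3
    then show ?thesis
      using null_plane_line[of 0 0 1] by (simp add: points_of_null_plane_infinity)
  qed
qed

lemma coordinate_lines_mem [simp]: "slanted m b \<in> pg_lines" "vertical c \<in> pg_lines" "infinity \<in> pg_lines"
  by (auto simp: pg_lines_eq)

lemma pg_line_cases:
  assumes "L \<in> pg_lines"
  obtains m b where "L = slanted m b" | c where "L = vertical c" | "L = infinity"
  using assms unfolding pg_lines_eq by (elim UnE imageE singletonE) (simp_all only: split_beta)

section \<open>Collineations and projective invariance\<close>

lemma linear_bij_subspace_image: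
  fixes f :: "'f::{field,finite} ^ 3 \<Rightarrow> 'f ^ 3"
  assumes "Vector_Spaces.linear (*s) (*s) f" "inj f" "vec.subspace W"
  shows "vec.subspace (f ` W)" "vec.dim (f ` W) = vec.dim W"
  using assms vec.linear_subspace_image[of f W] vec.dim_image_eq[of f W]
  by (simp_all add: inj_on_subset)

lemma linear_bij_image_pg_points:
  fixes f :: "'f::{field,finite} ^ 3 \<Rightarrow> 'f ^ 3"
  assumes "Vector_Spaces.linear (*s) (*s) f" "inj f"
  shows "(`) f ` pg_points = pg_points"
proof (rule endo_inj_surj)
  show "(`) f ` pg_points \<subseteq> pg_points"
  proof (rule image_subsetI)
    fix P :: "('f ^ 3) set"
    assume "P \<in> pg_points"
    then show "f ` P \<in> pg_points"
      unfolding pg_points_def mem_Collect_eq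
      using linear_bij_subspace_image[OF assms, of P] by (elim conjE) (simp only: simp_thms)
  qed
  show "inj_on ((`) f) pg_points"
    using assms(2) by (simp add: inj_on_def inj_image_eq_iff)
qed simp

lemma linear_bij_image_plane:
  fixes f :: "'f::{field,finite} ^ 3 \<Rightarrow> 'f ^ 3"
  assumes "Vector_Spaces.linear (*s) (*s) f" "inj f"
  shows "(`) f ` {P \<in> pg_points. P \<subseteq> W} = {P \<in> pg_points. P \<subseteq> f ` W}"
proof -
  have "(`) f ` {P \<in> pg_points. P \<subseteq> W} = {Q \<in> (`) f ` pg_points. Q \<subseteq> f ` W}"
    using assms(2) by (auto simp: inj_image_subset_iff)
  then show ?thesis
    unfolding linear_bij_image_pg_points[OF assms] .
qed

lemma linear_bij_collineation:
  fixes f :: "'f::{field,finite} ^ 3 \<Rightarrow> 'f ^ 3"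
  assumes "Vector_Spaces.linear (*s) (*s) f" "inj f"
  shows "collineation ((`) f)"
proof -
  have inj_img: "inj ((`) f)"
    using assms(2) by (simp add: inj_on_def inj_image_eq_iff)
  have lines: "(\<lambda>L. (`) f ` L) ` pg_lines \<subseteq> pg_lines"
  proof (rule image_subsetI)
    fix L :: "('f ^ 3) set set"
    assume "L \<in> pg_lines"
    then obtain W where W: "vec.subspace W" "vec.dim W = 2" "L = {P \<in> pg_points. P \<subseteq> W}"
      unfolding pg_lines_def by auto
    have "vec.subspace (f ` W) \<and> vec.dim (f ` W) = 2"
      using linear_bij_subspace_image[OF assms W(1)] W(2) by simp
    then show "(`) f ` L \<in> pg_lines"
      unfolding W(3) linear_bij_image_plane[OF assms] pg_lines_def by auto
  qed
  have "inj_on (\<lambda>L. (`) f ` L) pg_lines"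
    by (rule inj_onI) (simp only: inj_image_eq_iff[OF inj_img])
  with lines have "(\<lambda>L. (`) f ` L) ` pg_lines = pg_lines"
    by (intro endo_inj_surj) auto
  with linear_bij_image_pg_points[OF assms] inj_img show ?thesis
    by (simp add: collineation_def bij_betw_def inj_on_subset[OF _ subset_UNIV])
qed

lemma linear_image_span:
  assumes "Vector_Spaces.linear (*s) (*s) (f :: 'f::field ^ 'n \<Rightarrow> 'f ^ 'm)"
  shows "f ` vec.span {v} = vec.span {f v}"
  using vec.linear_span_image[OF assms, of "{v}"] by simp

text \<open>A flag is an incident point-line pair; some collineation maps the flag
  \<open>(vert, infinity)\<close> to any given one.\<close>

lemma flag_transitive:
  fixes P :: "('f::{field,finite} ^ 3) set"
  assumes "L \<in> pg_lines" "P \<in> L"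
  obtains h where "collineation h" "h vert = P" "h ` infinity = L"
proof -
  obtain W where W: "vec.subspace W" "vec.dim W = 2" "L = {P \<in> pg_points. P \<subseteq> W}"
    using assms unfolding pg_lines_def by auto
  with assms obtain u where u: "u \<noteq> 0" "P = vec.span {u}" "u \<in> W"
    by (auto simp: mem_pg_points_iff span_singleton_subset_iff)
  have "\<not> W \<subseteq> vec.span {u}"
    using vec.dim_subset[of W "vec.span {u}"] u W by auto
  then obtain v where v: "v \<in> W" "v \<notin> vec.span {u}"
    by auto
  have "W \<noteq> UNIV"
    using W(2) vec_dim_card[where 'a='f and 'n=3] by auto
  then obtain w where w: "w \<notin> W"
    by auto
  \<comment> \<open>A basis adapted to the flag: \<open>u\<close> spans \<open>P\<close>, and \<open>u\<close> and \<open>v\<close> span the plane of \<open>L\<close>.\<close>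
  define f where "f x = x $ 1 *s v + x $ 2 *s u + x $ 3 *s w" for x :: "'f ^ 3"
  have lin: "Vector_Spaces.linear (*s) (*s) f"
    by unfold_locales (auto simp: f_def vec3_eq_iff algebra_simps)
  have zero: "x = 0" if "f x = 0" for x
  proof -
    have uvW: "a *s v + b *s u \<in> W" for a b
      by (simp add: W(1) u(3) v(1) vec.subspace_add vec.subspace_scale)
    have "x $ 3 = 0"
    proof (rule ccontr)
      assume nz: "x $ 3 \<noteq> 0"
      have "w = (- x $ 1 / x $ 3) *s v + (- x $ 2 / x $ 3) *s u"
        using that nz by (simp add: f_def vec_eq_iff field_simps add_eq_0_iff) 
      with uvW w show False
        by metis
    qed
    moreover have "x $ 1 = 0"
    proof (rule ccontr)
      assume nz: "x $ 1 \<noteq> 0"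
      have "v = (- x $ 2 / x $ 1) *s u"
        using that nz \<open>x $ 3 = 0\<close> by (simp add: f_def vec_eq_iff field_simps add_eq_0_iff)
      with v(2) show False
        unfolding vec.span_singleton by blast
    qed
    moreover have "x $ 2 = 0"
      using that u(1) calculation by (simp add: f_def)
    ultimately show ?thesis
      by (simp add: vec3_eq_iff)
  qed
  then have inj: "inj f"
    using vec.linear_inj_iff_eq_0[OF lin] by blast
  note col = linear_bij_collineation[OF lin inj]
  have "f ` vert = P"
    unfolding vert_def linear_image_span[OF lin] u(2) by (simp add: f_def)
  moreover have "(`) f ` infinity = L"
  proof -
    have "f ` null_plane 0 0 1 \<subseteq> W"
      by (auto simp: f_def null_plane_def W(1) u(3) v(1) vec.subspace_add vec.subspace_scale)
    then have "f ` null_plane 0 0 1 = W"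
      using W linear_bij_subspace_image[OF lin inj subspace_null_plane, of 0 0 1] dim_null_plane[of "0::'f" 0 1]
      by (intro vec.subspace_dim_equal) simp_all
    then show ?thesis
      using linear_bij_image_plane[OF lin inj, of "null_plane 0 0 1"]
      by (simp add: W(3) points_of_null_plane_infinity)
  qed
  ultimately show ?thesis
    using col that by blast
qed


lemma projectively_equivalentI:
  assumes "collineation h" "S \<subseteq> pg_points" "h ` S = T"
  shows "(S, T) \<in> projectively_equivalent"
proof -
  have "T \<subseteq> pg_points"
    using assms by (auto simp: collineation_def bij_betw_def)
  with assms show ?thesis
    unfolding projectively_equivalent_def by blast
qed

lemma projectively_equivalentE:
  assumes "(S, T) \<in> projectively_equivalent"
  obtains h where "collineation h" "S \<subseteq> pg_points" "T \<subseteq> pg_points" "h ` S = T"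
  using assms unfolding projectively_equivalent_def by blast

lemma projectively_equivalent_sym:
  "(S, T) \<in> projectively_equivalent \<Longrightarrow> (T, S) \<in> projectively_equivalent"
  using equiv_projectively_equivalent by (rule equivE) (erule symE)

lemma projectively_equivalent_trans:
  "(S, T) \<in> projectively_equivalent \<Longrightarrow> (T, U) \<in> projectively_equivalent
    \<Longrightarrow> (S, U) \<in> projectively_equivalent"
  using equiv_projectively_equivalent by (rule equivE) (erule transE)

lemma pg_line_subset: "L \<in> pg_lines \<Longrightarrow> L \<subseteq> pg_points"
  unfolding pg_lines_def by auto

lemma collineation_card_image:
  assumes "collineation h" "A \<subseteq> pg_points"
  shows "card (h ` A) = card A"
  using assms by (metis card_image collineation_def bij_betw_def inj_on_subset)

lemma collineation_image_Int:
  assumes "collineation h" "A \<subseteq> pg_points" "B \<subseteq> pg_points"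
  shows "h ` (A \<inter> B) = h ` A \<inter> h ` B"
  using assms by (metis collineation_def bij_betw_def inj_on_image_Int)

lemma collineation_image_lines:
  assumes "collineation h"
  shows "(`) h ` pg_lines = pg_lines"
  using assms by (simp add: collineation_def)

lemma collineation_lineE:
  assumes "collineation h" "L' \<in> pg_lines"
  obtains L where "L \<in> pg_lines" "L' = h ` L"
  using collineation_image_lines[OF assms(1)] assms(2) by (metis imageE)

lemma projectively_equivalent_card:
  assumes "(S, T) \<in> projectively_equivalent"
  shows "card T = card S"
  using assms by (metis projectively_equivalentE collineation_card_image)

lemma blocking_set_equivalent:
  assumes "(S, T) \<in> projectively_equivalent" "blocking_set S"
  shows "blocking_set T"
proof -
  from assms(1) obtain h where h: "collineation h" "S \<subseteq> pg_points" "T \<subseteq> pg_points" "h ` S = T"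
    by (rule projectively_equivalentE)
  have "T \<inter> L' \<noteq> {} \<and> \<not> L' \<subseteq> T" if L': "L' \<in> pg_lines" for L'
  proof -
    obtain L where L: "L \<in> pg_lines" "L' = h ` L"
      using h(1) L' by (rule collineation_lineE)
    have "T \<inter> L' = h ` (S \<inter> L)"
      using collineation_image_Int[OF h(1,2) pg_line_subset[OF L(1)]] h(4) L(2) by simp
    moreover have "\<not> L' \<subseteq> T"
    proof
      have inj: "inj_on h pg_points"
        using h(1) by (simp add: collineation_def bij_betw_def)
      assume "L' \<subseteq> T"
      then have "L \<subseteq> S"
        using inj_on_image_mem_iff[OF inj _ h(2)] pg_line_subset[OF L(1)] L(2) h(4) by blast
      then show False
        using assms(2) L(1) by (simp add: blocking_set_def)
    qed
    ultimately show ?thesis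
      using assms(2) L(1) by (simp add: blocking_set_def)
  qed
  with h(3) show ?thesis
    by (simp add: blocking_set_def)
qed

lemma minimal_blocking_set_equivalent:
  assumes "(S, T) \<in> projectively_equivalent" "minimal_blocking_set S"
  shows "minimal_blocking_set T"
proof -
  from assms(1) obtain h where h: "collineation h" "S \<subseteq> pg_points" "T \<subseteq> pg_points" "h ` S = T"
    by (rule projectively_equivalentE)
  have "\<not> blocking_set T'" if "T' \<subset> T" for T'
  proof
    assume T': "blocking_set T'"
    define S' where "S' = {P \<in> S. h P \<in> T'}"
    have "h ` S' = T'"
      using that h(4) by (auto simp: S'_def)
    then have "S' \<subset> S"
      using that h(4) by (auto simp: S'_def)
    have "(S', T') \<in> projectively_equivalent"
      using h(1) _ \<open>h ` S' = T'\<close> by (rule projectively_equivalentI) (use h(2) in \<open>auto simp: S'_def\<close>)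
    then have "blocking_set S'"
      using T' blocking_set_equivalent projectively_equivalent_sym by blast
    with \<open>S' \<subset> S\<close> assms(2) show False
      by (simp add: minimal_blocking_set_def)
  qed
  moreover have "blocking_set T"
    using assms blocking_set_equivalent by (auto simp: minimal_blocking_set_def)
  ultimately show ?thesis
    by (simp add: minimal_blocking_set_def)
qed

lemma secant_sizes_equivalent:
  assumes "(S, T) \<in> projectively_equivalent"
  shows "(\<lambda>L. card (T \<inter> L)) ` pg_lines = (\<lambda>L. card (S \<inter> L)) ` pg_lines"
proof -
  from assms obtain h where h: "collineation h" "S \<subseteq> pg_points" "T \<subseteq> pg_points" "h ` S = T"
    by (rule projectively_equivalentE)
  have eq: "card (T \<inter> h ` L) = card (S \<inter> L)" if "L \<in> pg_lines" for L
    using collineation_image_Int[OF h(1,2) pg_line_subset[OF that]] h(2,4)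
      collineation_card_image[OF h(1) subset_trans[OF Int_lower1 h(2)], of L] pg_line_subset[OF that] by simp
  have "(\<lambda>L. card (T \<inter> L)) ` pg_lines = (\<lambda>L. card (T \<inter> h ` L)) ` pg_lines"
    by (subst (1) collineation_image_lines[OF h(1), symmetric]) (simp only: image_image)
  also have "\<dots> = (\<lambda>L. card (S \<inter> L)) ` pg_lines"
    by (rule image_cong) (simp_all only: eq)
  finally show ?thesis .
qed

lemma line_cover_equivalent:
  assumes "(S, T) \<in> projectively_equivalent" "M \<subseteq> pg_lines" "S \<subseteq> \<Union>M"
  shows "\<exists>M'. M' \<subseteq> pg_lines \<and> card M' = card M \<and> T \<subseteq> \<Union>M'"
proof -
  from assms(1) obtain h where h: "collineation h" "S \<subseteq> pg_points" "T \<subseteq> pg_points" "h ` S = T"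
    by (rule projectively_equivalentE)
  have "inj_on ((`) h) pg_lines"
    by (rule inj_on_subset[OF inj_on_image_Pow[of h pg_points]])
      (use h(1) pg_line_subset in \<open>auto simp: collineation_def bij_betw_def\<close>)
  then have "card ((`) h ` M) = card M"
    using assms(2) by (intro card_image) (rule inj_on_subset)
  moreover have "(`) h ` M \<subseteq> pg_lines"
    using image_mono[OF assms(2), of "(`) h"] collineation_image_lines[OF h(1)] by simp
  moreover have "T \<subseteq> \<Union>((`) h ` M)"
    using image_mono[OF assms(3), of h] h(4) by (simp add: image_Union)
  ultimately show ?thesis
    by blast
qed

lemma blocking_index_equivalent:
  assumes "(S, T) \<in> projectively_equivalent"
  shows "blocking_index T = blocking_index S"
proof -
  have "(\<exists>M. M \<subseteq> pg_lines \<and> card M = k \<and> T \<subseteq> \<Union>M) \<longleftrightarrow> (\<exists>M. M \<subseteq> pg_lines \<and> card M = k \<and> S \<subseteq> \<Union>M)" for k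
    using line_cover_equivalent[OF assms] line_cover_equivalent[OF projectively_equivalent_sym[OF assms]]
    by metis
  then show ?thesis
    by (simp add: blocking_index_def)
qed

text \<open>The family that is to be classified.\<close>

definition redei_index3 :: "('f::{field,finite} ^ 3) set set set" where
  "redei_index3 = {S. redei_blocking_set S \<and> blocking_index S = 3 \<and> card S = 14}"

lemma redei_index3_equivalent:
  assumes "(S, T) \<in> projectively_equivalent" "S \<in> redei_index3"
  shows "T \<in> redei_index3"
  using assms(2) minimal_blocking_set_equivalent[OF assms(1)] secant_sizes_equivalent[OF assms(1)]
    blocking_index_equivalent[OF assms(1)] projectively_equivalent_card[OF assms(1)]
  by (simp add: redei_index3_def redei_blocking_set_def)

section \<open>Blocking sets from graphs of functions\<close>

text \<open>The graph of \<open>f\<close> in the affine plane, together with all points at infinity except \<open>vert\<close>.\<close>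

definition graph_set :: "('f::{field,finite} \<Rightarrow> 'f) \<Rightarrow> ('f ^ 3) set set" where
  "graph_set f = range dir \<union> range (\<lambda>x. aff x (f x))"

text \<open>\<open>f\<close> determines every direction: each \<open>m\<close> is the slope of a chord of its graph.\<close>

definition all_slopes :: "('f::field \<Rightarrow> 'f) \<Rightarrow> bool" where
  "all_slopes f \<longleftrightarrow> (\<forall>m. \<exists>x x'. x \<noteq> x' \<and> f x - f x' = m * (x - x'))"

text \<open>The graph of \<open>f\<close> lies on two non-vertical lines (possibly equal).\<close>

definition two_line_cover :: "('f::field \<Rightarrow> 'f) \<Rightarrow> bool" where
  "two_line_cover f \<longleftrightarrow> (\<exists>m b m' b'. \<forall>x. f x = m * x + b \<or> f x = m' * x + b')"

lemma graph_set_subset: "graph_set f \<subseteq> pg_points"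
  by (auto simp: graph_set_def)

lemma mem_graph_set [simp]:
  "aff x y \<in> graph_set f \<longleftrightarrow> y = f x" "dir m \<in> graph_set f" "vert \<notin> graph_set f"
  by (auto simp: graph_set_def)

lemma card_range_dir: "card (range (dir :: 'f \<Rightarrow> ('f::{field,finite} ^ 3) set)) = CARD('f)"
  by (rule card_image) (simp add: inj_on_def)

lemma card_aff_image:
  "card ((\<lambda>x. aff x (f x)) ` A) = card A" for A :: "'f::{field,finite} set"
  by (rule card_image) (simp add: inj_on_def)

lemma card_graph_set:
  fixes f :: "'f::{field,finite} \<Rightarrow> 'f"
  shows "card (graph_set f) = 2 * CARD('f)"
proof -
  have "card (graph_set f) = card (range (dir :: 'f \<Rightarrow> _)) + card (range (\<lambda>x. aff x (f x)))"
    unfolding graph_set_def by (rule card_Un_disjoint) auto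
  then show ?thesis
    by (simp add: card_range_dir card_aff_image)
qed

lemma graph_set_Int_lines:
  "graph_set f \<inter> slanted m b = insert (dir m) ((\<lambda>x. aff x (f x)) ` {x. f x = m * x + b})"
  "graph_set f \<inter> vertical c = {aff c (f c)}"
  "graph_set f \<inter> infinity = range dir"
  by (auto simp: graph_set_def image_iff)

lemma card_graph_set_Int_lines:
  fixes f :: "'f::{field,finite} \<Rightarrow> 'f"
  shows "card (graph_set f \<inter> slanted m b) = Suc (card {x. f x = m * x + b})"
    "card (graph_set f \<inter> vertical c) = 1"
    "card (graph_set f \<inter> infinity) = CARD('f)"
proof -
  have "dir m \<notin> (\<lambda>x. aff x (f x)) ` {x. f x = m * x + b}"
    by auto
  then show "card (graph_set f \<inter> slanted m b) = Suc (card {x. f x = m * x + b})"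
    unfolding graph_set_Int_lines by (simp add: card_aff_image)
qed (simp_all add: graph_set_Int_lines card_range_dir)

text \<open>Affine maps that permute the vertical lines act on graphs.\<close>

lemma affine_equivalence:
  fixes f g :: "'f::{field,finite} \<Rightarrow> 'f"
  assumes nz: "\<alpha> \<noteq> 0" "\<gamma> \<noteq> 0"
    and g: "\<And>x. g (\<alpha> * x + \<beta>) = \<gamma> * f x + \<delta> * x + \<epsilon>"
  shows "(graph_set f, graph_set g) \<in> projectively_equivalent"
proof -
  define F :: "'f ^ 3 \<Rightarrow> 'f ^ 3" where
    "F v = vector [\<alpha> * v $ 1 + \<beta> * v $ 3, \<gamma> * v $ 2 + \<delta> * v $ 1 + \<epsilon> * v $ 3, v $ 3]" for v
  have lin: "Vector_Spaces.linear (*s) (*s) F"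
    by unfold_locales (auto simp: F_def vec3_eq_iff algebra_simps)
  have "v = 0" if "F v = 0" for v
    using that nz by (auto simp: F_def vec3_eq_iff)
  then have inj: "inj F"
    using vec.linear_inj_iff_eq_0[OF lin] by blast
  have Faff: "F ` aff x y = aff (\<alpha> * x + \<beta>) (\<gamma> * y + \<delta> * x + \<epsilon>)" for x y
    unfolding aff_def linear_image_span[OF lin] by (simp add: F_def)
  have Fdir: "F ` dir m = dir ((\<gamma> * m + \<delta>) / \<alpha>)" for m
    unfolding dir_def linear_image_span[OF lin]
    by (rule span_scale_eq[OF nz(1)]) (simp add: F_def vec3_eq_iff nz)
  have "(`) F ` graph_set f \<subseteq> graph_set g"
    by (auto simp: graph_set_def Faff Fdir simp flip: g)
  moreover have "card ((`) F ` graph_set f) = card (graph_set g)"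
    using collineation_card_image[OF linear_bij_collineation[OF lin inj] graph_set_subset]
    by (simp add: card_graph_set)
  ultimately have "(`) F ` graph_set f = graph_set g"
    by (intro card_subset_eq) auto
  then show ?thesis
    by (intro projectively_equivalentI[OF linear_bij_collineation[OF lin inj] graph_set_subset])
qed

lemma all_slopes_not_linear:
  assumes "all_slopes f"
  shows "\<exists>x. f x \<noteq> m * x + b"
proof (rule ccontr)
  assume "\<not> ?thesis"
  then have "f x = m * x + b" for x
    by blast
  moreover obtain x x' where "x \<noteq> x'" "f x - f x' = (m + 1) * (x - x')"
    using assms unfolding all_slopes_def by blast
  ultimately show False
    by (simp add: algebra_simps)
qed

text \<open>On a finite field \<open>x \<mapsto> f x - m * x\<close> is injective iff it is surjective, so a direction is
  determined iff some line of that slope misses the graph.  This is the tangent that makes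
  \<open>dir m\<close> an essential point of \<open>graph_set f\<close>.\<close>

lemma slope_iff_missed_line:
  fixes f :: "'f::{field,finite} \<Rightarrow> 'f"
  shows "(\<exists>x x'. x \<noteq> x' \<and> f x - f x' = m * (x - x')) \<longleftrightarrow> (\<exists>b. \<forall>x. f x \<noteq> m * x + b)"
proof -
  have "(\<exists>x x'. x \<noteq> x' \<and> f x - f x' = m * (x - x')) \<longleftrightarrow> \<not> inj (\<lambda>x. f x - m * x)"
    by (auto simp: inj_on_def algebra_simps)
  also have "\<dots> \<longleftrightarrow> \<not> surj (\<lambda>x. f x - m * x)"
    by (metis finite_UNIV_inj_surj finite_UNIV_surj_inj finite)
  also have "\<dots> \<longleftrightarrow> (\<exists>b. \<forall>x. f x \<noteq> m * x + b)"
  proof -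
    have "(b = f x - m * x) = (f x = m * x + b)" for b x
      by (auto simp: algebra_simps)
    then show ?thesis
      by (simp add: surj_def)
  qed
  finally show ?thesis .
qed

text \<open>Any other line contains only one point at infinity, so a cover of the directions by few lines
  must use the line at infinity.\<close>

lemma cover_infinity:
  fixes M :: "('f::{field,finite} ^ 3) set set set"
  assumes "M \<subseteq> pg_lines" "range dir \<subseteq> \<Union>M" "infinity \<notin> M"
  shows "CARD('f) \<le> card M"
proof -
  have "\<exists>b. slanted m b \<in> M" for m :: 'f
  proof -
    obtain L where L: "L \<in> M" "dir m \<in> L"
      using assms(2) by blast
    with assms have line: "L \<in> pg_lines" "L \<noteq> infinity"
      by auto
    from line(1) show ?thesis
      by (cases rule: pg_line_cases) (use L line(2) in auto)
  qed
  then obtain b where b: "slanted m (b m) \<in> M" for m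
    by metis
  have "inj (\<lambda>m. slanted m (b m))"
  proof (rule injI)
    fix m m' assume "slanted m (b m) = slanted m' (b m')"
    then have "dir m \<in> slanted m' (b m')"
      by (metis coordinate_incidence(2))
    then show "m = m'" by simp
  qed
  then show ?thesis
    using b by (intro card_inj_on_le) auto
qed

text \<open>A vertical line meets the graph in one point, so it can be traded for a horizontal line.\<close>

lemma line_meets_graph:
  assumes "L \<in> pg_lines" "L \<noteq> infinity"
  obtains m b where "\<And>x. aff x (f x) \<in> L \<Longrightarrow> f x = m * x + b"
  using assms
proof (cases rule: pg_line_cases)
  case (2 c)
  then show ?thesis
    using that[of 0 "f c"] by auto
qed (use that in auto)

lemma graph_set_minimal_blocking:
  fixes f :: "'f::{field,finite} \<Rightarrow> 'f"
  assumes f: "all_slopes f"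
  shows "minimal_blocking_set (graph_set f)"
proof -
  have "graph_set f \<inter> L \<noteq> {} \<and> \<not> L \<subseteq> graph_set f" if "L \<in> pg_lines" for L
    using that
  proof (cases rule: pg_line_cases)
    case (1 m b)
    obtain x where "f x \<noteq> m * x + b"
      using all_slopes_not_linear[OF f] by blast
    then have "aff x (m * x + b) \<in> L - graph_set f"
      by (simp add: 1)
    then have "\<not> L \<subseteq> graph_set f"
      by blast
    then show ?thesis
      by (simp add: 1 graph_set_Int_lines)
  next
    case (2 c)
    have "vert \<in> L - graph_set f"
      by (simp add: 2)
    then have "\<not> L \<subseteq> graph_set f"
      by blast
    then show ?thesis
      by (simp add: 2 graph_set_Int_lines)
  next
    case 3
    have "vert \<in> L - graph_set f"
      by (simp add: 3)
    then have "\<not> L \<subseteq> graph_set f"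
      by blast
    then show ?thesis
      by (simp add: 3 graph_set_Int_lines)
  qed
  then have block: "blocking_set (graph_set f)"
    by (simp add: blocking_set_def graph_set_subset)
  have "\<not> blocking_set T" if T: "T \<subset> graph_set f" for T
  proof -
    obtain P where P: "P \<in> graph_set f" "P \<notin> T"
      using T by blast
    have "\<exists>L \<in> pg_lines. graph_set f \<inter> L = {P}"
    proof -
      consider m where "P = dir m" | x where "P = aff x (f x)"
        using P(1) by (auto simp: graph_set_def)
      then show ?thesis
      proof cases
        case (1 m)
        obtain b where "\<forall>x. f x \<noteq> m * x + b"
          using f slope_iff_missed_line[of f m] unfolding all_slopes_def by auto
        then have "graph_set f \<inter> slanted m b = {P}"
          by (simp add: graph_set_Int_lines 1)
        then show ?thesis
          by (intro bexI) auto
      next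
        case (2 x)
        then have "graph_set f \<inter> vertical x = {P}"
          by (simp add: graph_set_Int_lines)
        then show ?thesis
          by (intro bexI) auto
      qed
    qed
    then obtain L where L: "L \<in> pg_lines" "graph_set f \<inter> L = {P}"
      by blast
    have "T \<inter> L \<subseteq> graph_set f \<inter> L"
      by (rule Int_mono[OF psubset_imp_subset[OF T] order_refl])
    with L(2) P(2) have "T \<inter> L = {}"
      by (auto simp: subset_singleton_iff)
    with L(1) show ?thesis
      unfolding blocking_set_def by blast
  qed
  with block show ?thesis
    by (simp add: minimal_blocking_set_def)
qed

lemma graph_set_redei:
  fixes f :: "'f::{field,finite} \<Rightarrow> 'f"
  assumes f: "all_slopes f"
  shows "redei_blocking_set (graph_set f)"
proof -
  have "Max ((\<lambda>L. card (graph_set f \<inter> L)) ` pg_lines) = CARD('f)"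
  proof (rule Max_eqI)
    show "CARD('f) \<in> (\<lambda>L. card (graph_set f \<inter> L)) ` pg_lines"
      using card_graph_set_Int_lines(3)[of f] by (intro image_eqI[of _ _ infinity]) auto
    fix k assume "k \<in> (\<lambda>L. card (graph_set f \<inter> L)) ` pg_lines"
    then obtain L where L: "L \<in> pg_lines" "k = card (graph_set f \<inter> L)"
      by auto
    from L(1) show "k \<le> CARD('f)"
    proof (cases rule: pg_line_cases)
      case (1 m b)
      obtain x where "f x \<noteq> m * x + b"
        using all_slopes_not_linear[OF f] by blast
      then have "{x. f x = m * x + b} \<subset> UNIV"
        by blast
      then have "card {x. f x = m * x + b} < CARD('f)"
        by (rule psubset_card_mono[OF finite])
      then show ?thesis
        by (simp add: L(2) 1 card_graph_set_Int_lines)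
    qed (simp_all add: L(2) card_graph_set_Int_lines)
  qed simp
  moreover have "card (graph_set f) = CARD('f) + CARD('f)"
    by (simp only: card_graph_set mult_2)
  ultimately show ?thesis
    using graph_set_minimal_blocking[OF f] unfolding redei_blocking_set_def by blast
qed

lemma graph_set_index:
  fixes f :: "'f::{field,finite} \<Rightarrow> 'f"
  assumes f: "all_slopes f" and cover: "two_line_cover f" and card: "CARD('f) \<ge> 3"
  shows "blocking_index (graph_set f) = 3"
  unfolding blocking_index_def
proof (rule Least_equality)
  obtain m b m' b' where mb: "\<And>x. f x = m * x + b \<or> f x = m' * x + b'"
    using cover unfolding two_line_cover_def by blast
  define M where "M = {infinity, slanted m b, slanted m' b'}"
  have "aff x (f x) \<in> \<Union>M" for x
    using mb[of x] by (auto simp: M_def)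
  moreover have "dir n \<in> \<Union>M" for n
    by (simp add: M_def)
  ultimately have "graph_set f \<subseteq> \<Union>M"
    unfolding graph_set_def by (intro Un_least image_subsetI)
  moreover have "slanted m b \<noteq> slanted m' b'"
  proof
    assume eq: "slanted m b = slanted m' b'"
    have "m' * x + b' = m * x + b" for x
      using coordinate_incidence(1)[of x "m' * x + b'" m b] unfolding eq by simp
    with mb all_slopes_not_linear[OF f, of m b] show False
      by metis
  qed
  moreover have "infinity \<noteq> slanted n c" for n c :: 'f
    by (metis coordinate_incidence(3,9))
  ultimately show "\<exists>M. M \<subseteq> pg_lines \<and> card M = 3 \<and> graph_set f \<subseteq> \<Union>M"
    by (intro exI[of _ M]) (simp add: M_def)
next
  fix k assume "\<exists>M. M \<subseteq> pg_lines \<and> card M = k \<and> graph_set f \<subseteq> \<Union>M"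
  then obtain M where M: "M \<subseteq> pg_lines" "card M = k" "graph_set f \<subseteq> \<Union>M"
    by blast
  show "3 \<le> k"
  proof (cases "infinity \<in> M")
    case False
    have "range dir \<subseteq> \<Union>M"
      using M(3) by (auto simp: graph_set_def)
    then show ?thesis
      using cover_infinity[OF M(1) _ False] card M(2) by simp
  next
    case True
    show ?thesis
    proof (rule ccontr)
      assume "\<not> 3 \<le> k"
      with M(2) True have "card (M - {infinity}) \<le> 1"
        by simp
      then obtain L where L: "M - {infinity} \<subseteq> {L}"
        by (metis One_nat_def card_le_Suc0_iff_eq finite insertI1 subsetI singletonI)
      have all: "L \<in> M - {infinity} \<and> aff x (f x) \<in> L" for x
      proof -
        have "aff x (f x) \<in> \<Union>M"
          using M(3) by (rule subsetD) simp
        then obtain L' where "L' \<in> M" "aff x (f x) \<in> L'"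
          by blast
        moreover from this have "L' \<noteq> infinity"
          by auto
        ultimately show ?thesis
          using L by blast
      qed
      then have "L \<in> pg_lines" "L \<noteq> infinity"
        using M(1) by auto
      then obtain n c where "\<And>x. aff x (f x) \<in> L \<Longrightarrow> f x = n * x + c"
        by (rule line_meets_graph[where f = f]) blast
      with all all_slopes_not_linear[OF f] show False
        by blast
    qed
  qed
qed

lemma graph_set_mem_redei_index3:
  fixes f :: "'f::{field,finite} \<Rightarrow> 'f"
  assumes "CARD('f) = 7" "all_slopes f" "two_line_cover f"
  shows "graph_set f \<in> redei_index3"
  using assms by (simp add: redei_index3_def graph_set_redei graph_set_index card_graph_set)

lemma minimal_blocking_imp_all_slopes:
  fixes f :: "'f::{field,finite} \<Rightarrow> 'f"
  assumes "minimal_blocking_set (graph_set f)"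
  shows "all_slopes f"
  unfolding all_slopes_def
proof
  fix m
  have "graph_set f - {dir m} \<subset> graph_set f"
    using mem_graph_set(2)[of m f] by blast
  then have "\<not> blocking_set (graph_set f - {dir m})"
    using assms by (simp add: minimal_blocking_set_def)
  moreover have "graph_set f - {dir m} \<subseteq> pg_points"
    using graph_set_subset by blast
  ultimately obtain L where L: "L \<in> pg_lines" "(graph_set f - {dir m}) \<inter> L = {} \<or> L \<subseteq> graph_set f - {dir m}"
    unfolding blocking_set_def by blast
  have "\<not> L \<subseteq> graph_set f"
    using assms L(1) by (auto simp: minimal_blocking_set_def blocking_set_def)
  with L(2) have disj: "graph_set f \<inter> L \<subseteq> {dir m}"
    by blast
  from L(1) show "\<exists>x x'. x \<noteq> x' \<and> f x - f x' = m * (x - x')"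
  proof (cases rule: pg_line_cases)
    case (1 m' b)
    with disj have "m' = m" "\<forall>x. f x \<noteq> m' * x + b"
      by (auto simp: graph_set_Int_lines)
    then show ?thesis
      unfolding slope_iff_missed_line by blast
  next
    case (2 c)
    with disj show ?thesis
      by (simp add: graph_set_Int_lines)
  next
    case 3
    have "dir (m + 1) \<in> graph_set f \<inter> L"
      by (simp add: 3)
    with disj have "dir (m + 1) = dir m"
      by blast
    then show ?thesis
      by simp
  qed
qed

lemma index_3_imp_two_line_cover:
  fixes f :: "'f::{field,finite} \<Rightarrow> 'f"
  assumes index: "blocking_index (graph_set f) = 3" and card: "CARD('f) > 3"
  shows "two_line_cover f"
proof -
  have "graph_set f \<subseteq> \<Union>pg_lines"
  proof
    fix P assume "P \<in> graph_set f"
    then have "P \<in> infinity \<or> (\<exists>x. P \<in> vertical x)"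
      by (auto simp: graph_set_def)
    then show "P \<in> \<Union>pg_lines"
      by (elim disjE exE) auto
  qed
  then have "\<exists>k. \<exists>M. M \<subseteq> pg_lines \<and> card M = k \<and> graph_set f \<subseteq> \<Union>M"
    by (intro exI[of _ "card pg_lines"] exI[of _ pg_lines]) simp
  then have "\<exists>M. M \<subseteq> pg_lines \<and> card M = blocking_index (graph_set f) \<and> graph_set f \<subseteq> \<Union>M"
    unfolding blocking_index_def by (rule LeastI_ex)
  then obtain M where M: "M \<subseteq> pg_lines" "card M = 3" "graph_set f \<subseteq> \<Union>M"
    unfolding index by blast
  have "infinity \<in> M"
  proof (rule ccontr)
    assume "infinity \<notin> M"
    moreover have "range dir \<subseteq> \<Union>M"
      using M(3) by (auto simp: graph_set_def)
    ultimately show False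
      using cover_infinity[OF M(1)] M(2) card by simp
  qed
  with M(2) have "card (M - {infinity}) = 2"
    by simp
  then obtain L1 L2 where L: "M - {infinity} = {L1, L2}"
    by (auto simp: card_2_iff)
  then have lines: "L1 \<in> pg_lines" "L1 \<noteq> infinity" "L2 \<in> pg_lines" "L2 \<noteq> infinity"
    using M(1) by auto
  obtain m1 b1 where 1: "\<And>x. aff x (f x) \<in> L1 \<Longrightarrow> f x = m1 * x + b1"
    using lines(1,2) by (rule line_meets_graph[where f = f]) blast
  obtain m2 b2 where 2: "\<And>x. aff x (f x) \<in> L2 \<Longrightarrow> f x = m2 * x + b2"
    using lines(3,4) by (rule line_meets_graph[where f = f]) blast
  have "aff x (f x) \<in> L1 \<or> aff x (f x) \<in> L2" for x
  proof -
    have "aff x (f x) \<in> \<Union>M"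
      using M(3) by (rule subsetD) simp
    then obtain L' where "L' \<in> M" "aff x (f x) \<in> L'"
      by blast
    moreover from this have "L' \<noteq> infinity"
      by auto
    ultimately show ?thesis
      using L by blast
  qed
  with 1 2 show ?thesis
    unfolding two_line_cover_def by metis
qed

text \<open>The seven-point line of \<open>S\<close> is moved to infinity with its missing point at \<open>vert\<close>.  Each
  vertical line must then be blocked by an affine point; since only seven affine points are left,
  they form the graph of a function.\<close>

theorem redei_index3_normal_form:
  fixes S :: "('f::{field,finite} ^ 3) set set"
  assumes card: "CARD('f) = 7" and S: "S \<in> redei_index3"
  obtains f where "(S, graph_set f) \<in> projectively_equivalent" "all_slopes f" "two_line_cover f"
proof -
  from S have S': "redei_blocking_set S" "card S = 14"
    by (auto simp: redei_index3_def)
  then have "Max ((\<lambda>L. card (S \<inter> L)) ` pg_lines) = 7"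
    using card by (auto simp: redei_blocking_set_def)
  moreover have "pg_lines \<noteq> ({} :: ('f ^ 3) set set set)"
    using coordinate_lines_mem(3) by blast
  then have "Max ((\<lambda>L. card (S \<inter> L)) ` pg_lines) \<in> (\<lambda>L. card (S \<inter> L)) ` pg_lines"
    by (intro Max_in) simp_all
  ultimately obtain L where L: "L \<in> pg_lines" "card (S \<inter> L) = 7"
    by (auto simp del: coordinate_lines_mem)
  have "\<not> L \<subseteq> S"
    using S' L(1) by (auto simp: redei_blocking_set_def minimal_blocking_set_def blocking_set_def)
  then obtain P where P: "P \<in> L" "P \<notin> S"
    by blast
  obtain h where h: "collineation h" "h vert = P" "h ` infinity = L"
    using flag_transitive[OF L(1) P(1)] by blast
  have Spts: "S \<subseteq> pg_points"
    using S' by (simp add: redei_blocking_set_def minimal_blocking_set_def blocking_set_def)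
  have bij: "bij_betw h pg_points pg_points"
    using h(1) by (simp add: collineation_def)
  define T where "T = {Q \<in> pg_points. h Q \<in> S}"
  have "S \<subseteq> h ` pg_points"
    using Spts bij by (simp add: bij_betw_def)
  then have T: "T \<subseteq> pg_points" "h ` T = S"
    by (auto simp: T_def)
  have TS: "(T, S) \<in> projectively_equivalent"
    using projectively_equivalentI[OF h(1) T] .
  have ST: "(S, T) \<in> projectively_equivalent"
    using TS by (rule projectively_equivalent_sym)
  have T3: "T \<in> redei_index3"
    using redei_index3_equivalent[OF ST S] .
  then have T14: "card T = 14" "minimal_blocking_set T" "blocking_index T = 3"
    by (auto simp: redei_index3_def redei_blocking_set_def)
  have "vert \<notin> T"
    using P(2) h(2) by (simp add: T_def)
  then have sub: "T \<inter> infinity \<subseteq> range dir"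
    by (auto simp: infinity_def)
  have "card (T \<inter> infinity) = card (h ` (T \<inter> infinity))"
    using collineation_card_image[OF h(1) subset_trans[OF Int_lower1 T(1)]] by simp
  also have "h ` (T \<inter> infinity) = S \<inter> L"
    using collineation_image_Int[OF h(1) T(1) coordinate_lines_subset(3)] T(2) h(3) by simp
  finally have "card (T \<inter> infinity) = card (range (dir :: 'f \<Rightarrow> _))"
    using L(2) card by (simp add: card_range_dir)
  then have dirs: "T \<inter> infinity = range dir"
    using sub by (intro card_subset_eq) auto
  have "\<exists>y. aff x y \<in> T" for x
  proof -
    have "T \<inter> vertical x \<noteq> {}"
      using T14(2) by (simp add: minimal_blocking_set_def blocking_set_def)
    with \<open>vert \<notin> T\<close> show ?thesis
      by (auto simp: vertical_def)
  qed
  then obtain f where f: "aff x (f x) \<in> T" for x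
    by metis
  have "graph_set f \<subseteq> T"
    using f dirs by (auto simp: graph_set_def)
  moreover have "card (graph_set f) = card T"
    using T14(1) card by (simp add: card_graph_set)
  ultimately have "graph_set f = T"
    by (intro card_subset_eq) auto
  then show ?thesis
    using that[of f] ST T14 card minimal_blocking_imp_all_slopes index_3_imp_two_line_cover by fastforce
qed

section \<open>The field with seven elements\<close>

lemma of_nat_CARD: "of_nat CARD('f) = (0 :: 'f::{field,finite})"
proof -
  have "(\<Sum>x\<in>UNIV. x + 1) = (\<Sum>x\<in>UNIV. x :: 'f)"
    by (rule sum.reindex_bij_witness[of _ "\<lambda>x. x - 1" "\<lambda>x. x + 1"]) auto
  then show ?thesis
    by (simp add: sum.distrib)
qed

lemma of_nat_mod_7:
  assumes "CARD('f::{field,finite}) = 7"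
  shows "(of_nat (n mod 7) :: 'f) = of_nat n"
proof -
  have 7: "of_nat 7 = (0 :: 'f)"
    using of_nat_CARD[where 'f = 'f] assms by simp
  have "(of_nat n :: 'f) = of_nat (7 * (n div 7) + n mod 7)"
    by simp
  also have "\<dots> = of_nat (n mod 7)"
    unfolding of_nat_add of_nat_mult 7 by simp
  finally show ?thesis ..
qed

lemma of_nat_eq_iff_mod_7:
  assumes card: "CARD('f::{field,finite}) = 7"
  shows "(of_nat m :: 'f) = of_nat n \<longleftrightarrow> m mod 7 = n mod 7"
proof
  assume eq: "(of_nat m :: 'f) = of_nat n"
  have nz: "of_nat k \<noteq> (0 :: 'f)" if "0 < k" "k < 7" for k :: nat
  proof
    assume 0: "of_nat k = (0 :: 'f)"
    have "k \<in> {1, 2, 3, 4, 5, 6}"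
      using that by auto
    then have "\<exists>l. (k * l) mod 7 = 1"
      by (elim insertE emptyE) (auto intro: exI[of _ 1] exI[of _ 2] exI[of _ 3] exI[of _ 4] exI[of _ 5] exI[of _ 6])
    then obtain l where "(k * l) mod 7 = 1" ..
    then have "(of_nat (k * l) :: 'f) = 1"
      by (metis card of_nat_1 of_nat_mod_7)
    with 0 show False
      by simp
  qed
  have *: "i = j" if "i \<le> j" "j < 7" "(of_nat i :: 'f) = of_nat j" for i j :: nat
  proof (rule ccontr)
    assume "i \<noteq> j"
    with that have "0 < j - i" "j - i < 7"
      by simp_all
    with nz[of "j - i"] that show False
      by (simp add: of_nat_diff)
  qed
  have "(of_nat (m mod 7) :: 'f) = of_nat (n mod 7)"
    using eq by (simp only: of_nat_mod_7[OF card])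
  then show "m mod 7 = n mod 7"
    using *[of "m mod 7" "n mod 7"] *[of "n mod 7" "m mod 7"]
    by (metis mod_less_divisor nat_le_linear zero_less_numeral)
next
  assume "m mod 7 = n mod 7"
  then show "(of_nat m :: 'f) = of_nat n"
    by (metis card of_nat_mod_7)
qed

text \<open>The next two lemmas make arithmetic with numerals in the field decidable by rewriting; the
  numerals cover all values \<open>a * b + c\<close> with \<open>a\<close>, \<open>b\<close>, \<open>c\<close> reduced.\<close>

lemma numeral_mod_7:
  assumes card: "CARD('f::{field,finite}) = 7"
  shows
    "(7 :: 'f) = 0" "(8 :: 'f) = 1" "(9 :: 'f) = 2" "(10 :: 'f) = 3" "(11 :: 'f) = 4"
    "(12 :: 'f) = 5" "(13 :: 'f) = 6" "(14 :: 'f) = 0" "(15 :: 'f) = 1" "(16 :: 'f) = 2"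
    "(17 :: 'f) = 3" "(18 :: 'f) = 4" "(19 :: 'f) = 5" "(20 :: 'f) = 6" "(21 :: 'f) = 0"
    "(22 :: 'f) = 1" "(23 :: 'f) = 2" "(24 :: 'f) = 3" "(25 :: 'f) = 4" "(26 :: 'f) = 5"
    "(27 :: 'f) = 6" "(28 :: 'f) = 0" "(29 :: 'f) = 1" "(30 :: 'f) = 2" "(31 :: 'f) = 3"
    "(32 :: 'f) = 4" "(33 :: 'f) = 5" "(34 :: 'f) = 6" "(35 :: 'f) = 0" "(36 :: 'f) = 1"
    "(37 :: 'f) = 2" "(38 :: 'f) = 3" "(39 :: 'f) = 4" "(40 :: 'f) = 5" "(41 :: 'f) = 6"
    "(42 :: 'f) = 0"
  using of_nat_eq_iff_mod_7[OF card, of "numeral _" "numeral _"]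
    of_nat_eq_iff_mod_7[OF card, of "numeral _" 0] of_nat_eq_iff_mod_7[OF card, of "numeral _" 1]
  by simp_all

lemma residues_7_distinct:
  assumes card: "CARD('f::{field,finite}) = 7"
  shows
    "(0 :: 'f) \<noteq> 1" "(0 :: 'f) \<noteq> 2" "(0 :: 'f) \<noteq> 3" "(0 :: 'f) \<noteq> 4"
    "(0 :: 'f) \<noteq> 5" "(0 :: 'f) \<noteq> 6" "(1 :: 'f) \<noteq> 0" "(1 :: 'f) \<noteq> 2"
    "(1 :: 'f) \<noteq> 3" "(1 :: 'f) \<noteq> 4" "(1 :: 'f) \<noteq> 5" "(1 :: 'f) \<noteq> 6"
    "(2 :: 'f) \<noteq> 0" "(2 :: 'f) \<noteq> 1" "(2 :: 'f) \<noteq> 3" "(2 :: 'f) \<noteq> 4"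
    "(2 :: 'f) \<noteq> 5" "(2 :: 'f) \<noteq> 6" "(3 :: 'f) \<noteq> 0" "(3 :: 'f) \<noteq> 1"
    "(3 :: 'f) \<noteq> 2" "(3 :: 'f) \<noteq> 4" "(3 :: 'f) \<noteq> 5" "(3 :: 'f) \<noteq> 6"
    "(4 :: 'f) \<noteq> 0" "(4 :: 'f) \<noteq> 1" "(4 :: 'f) \<noteq> 2" "(4 :: 'f) \<noteq> 3"
    "(4 :: 'f) \<noteq> 5" "(4 :: 'f) \<noteq> 6" "(5 :: 'f) \<noteq> 0" "(5 :: 'f) \<noteq> 1"
    "(5 :: 'f) \<noteq> 2" "(5 :: 'f) \<noteq> 3" "(5 :: 'f) \<noteq> 4" "(5 :: 'f) \<noteq> 6"
    "(6 :: 'f) \<noteq> 0" "(6 :: 'f) \<noteq> 1" "(6 :: 'f) \<noteq> 2" "(6 :: 'f) \<noteq> 3"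
    "(6 :: 'f) \<noteq> 4" "(6 :: 'f) \<noteq> 5"
  using of_nat_eq_iff_mod_7[OF card, of "numeral _" "numeral _"]
    of_nat_eq_iff_mod_7[OF card, of "numeral _" 0] of_nat_eq_iff_mod_7[OF card, of "numeral _" 1]
    of_nat_eq_iff_mod_7[OF card, of 0 "numeral _"] of_nat_eq_iff_mod_7[OF card, of 1 "numeral _"]
  by simp_all

lemma UNIV_7_of_nat:
  assumes card: "CARD('f::{field,finite}) = 7"
  shows "(UNIV :: 'f set) = of_nat ` {..<7}"
proof (rule card_subset_eq[symmetric])
  have "inj_on (of_nat :: nat \<Rightarrow> 'f) {..<7}"
    using of_nat_eq_iff_mod_7[OF card] by (auto simp: inj_on_def)
  then show "card (of_nat ` {..<7} :: 'f set) = CARD('f)"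
    by (simp add: card_image card)
qed auto

lemma of_nat_7_cases:
  fixes x :: "'f::{field,finite}"
  assumes card: "CARD('f) = 7"
  obtains i where "i < 7" "x = of_nat i"
proof -
  have "x \<in> of_nat ` {..<7}"
    unfolding UNIV_7_of_nat[OF card, symmetric] by simp
  then show ?thesis
    using that by auto
qed

lemma UNIV_7:
  assumes card: "CARD('f::{field,finite}) = 7"
  shows "(UNIV :: 'f set) = {0, 1, 2, 3, 4, 5, 6}"
proof -
  have "{..<7::nat} = {0, 1, 2, 3, 4, 5, 6}"
    by auto
  then show ?thesis
    unfolding UNIV_7_of_nat[OF card] by simp
qed

section \<open>Reduction to eight representatives\<close>

text \<open>The two shapes of functions whose graph lies on two lines: \<open>indic A\<close> uses the parallel lines
  \<open>y = 0\<close> and \<open>y = 1\<close>, and \<open>wedge A\<close> the intersecting lines \<open>y = 0\<close> and \<open>y = x\<close>.  In both cases \<open>A\<close>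
  is the set where the value lies on \<open>y = 0\<close>; for \<open>wedge A\<close> it is immaterial whether \<open>0 \<in> A\<close>.\<close>

definition indic :: "'f::field set \<Rightarrow> 'f \<Rightarrow> 'f" where
  "indic A x = (if x \<in> A then 0 else 1)"

definition wedge :: "'f::field set \<Rightarrow> 'f \<Rightarrow> 'f" where
  "wedge A x = (if x \<in> A then 0 else x)"

abbreviation graph_equiv :: "('f::{field,finite} \<Rightarrow> 'f) \<Rightarrow> ('f \<Rightarrow> 'f) \<Rightarrow> bool" where
  "graph_equiv f g \<equiv> (graph_set f, graph_set g) \<in> projectively_equivalent"

lemma indic_affine:
  assumes "\<alpha> \<noteq> 0"
  shows "graph_equiv (indic A) (indic ((\<lambda>x. \<alpha> * x + \<beta>) ` A))"
  by (rule affine_equivalence[where \<alpha> = \<alpha> and \<beta> = \<beta> and \<gamma> = 1 and \<delta> = 0 and \<epsilon> = 0])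
    (use assms in \<open>auto simp: indic_def\<close>)

lemma indic_compl: "graph_equiv (indic A) (indic (- A))"
  by (rule affine_equivalence[where \<alpha> = 1 and \<beta> = 0 and \<gamma> = "-1" and \<delta> = 0 and \<epsilon> = 1])
    (auto simp: indic_def)

lemma wedge_scale:
  assumes "\<alpha> \<noteq> 0"
  shows "graph_equiv (wedge A) (wedge ((*) \<alpha> ` A))"
  by (rule affine_equivalence[where \<alpha> = \<alpha> and \<beta> = 0 and \<gamma> = \<alpha> and \<delta> = 0 and \<epsilon> = 0])
    (use assms in \<open>auto simp: wedge_def\<close>)

lemma wedge_compl: "graph_equiv (wedge A) (wedge (- A))"
  by (rule affine_equivalence[where \<alpha> = 1 and \<beta> = 0 and \<gamma> = "-1" and \<delta> = 1 and \<epsilon> = 0])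
    (auto simp: wedge_def)

lemma wedge_remove_0: "wedge (A - {0}) = wedge A"
  by (auto simp: wedge_def fun_eq_iff)

text \<open>A wedge with one exceptional point has all other points on one line, so it is also of the
  parallel shape.\<close>

lemma wedge_singleton:
  assumes "a \<noteq> 0"
  shows "graph_equiv (wedge {a}) (indic (- {a}))"
  by (rule affine_equivalence[where \<alpha> = 1 and \<beta> = 0 and \<gamma> = "- 1 / a" and \<delta> = "1 / a" and \<epsilon> = 0])
    (use assms in \<open>auto simp: wedge_def indic_def\<close>)

lemma two_line_cover_normal_form:
  fixes f :: "'f::{field,finite} \<Rightarrow> 'f"
  assumes "two_line_cover f" "all_slopes f"
  obtains A where "graph_equiv f (indic A)" | A where "graph_equiv f (wedge A)"
proof -
  obtain m b m' b' where mb: "\<And>x. f x = m * x + b \<or> f x = m' * x + b'"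
    using assms(1) unfolding two_line_cover_def by blast
  \<comment> \<open>Subtracting the first line turns it into \<open>y = 0\<close>; the second becomes \<open>y = M x + B\<close>.\<close>
  define M where "M = m' - m"
  define B where "B = b' - b"
  have f: "f x = m * x + b \<or> f x = M * x + B + m * x + b" for x
    using mb[of x] by (auto simp: M_def B_def algebra_simps)
  show ?thesis
  proof (cases "M = 0")
    case True
    have "B \<noteq> 0"
      using f True all_slopes_not_linear[OF assms(2), of m b] by auto
    have "indic {x. f x = m * x + b} (1 * x + 0) = (1 / B) * f x + (- m / B) * x + (- b / B)" for x
      using f[of x] True \<open>B \<noteq> 0\<close> by (auto simp: indic_def field_simps)
    from affine_equivalence[OF _ _ this] \<open>B \<noteq> 0\<close> that(1) show ?thesis
      by simp
  next
    case False
    have "wedge {x. f (x - B / M) = m * (x - B / M) + b} (1 * x + B / M)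
        = (1 / M) * f x + (- m / M) * x + (- b / M)" for x
    proof -
      have "(1 / M) * f x + (- m / M) * x + (- b / M) = (f x - (m * x + b)) / M"
        by (simp add: diff_divide_distrib add_divide_distrib)
      moreover have "f x = m * x + b \<or> f x - (m * x + b) = M * (x + B / M)"
        using f[of x] False by (auto simp: distrib_left)
      ultimately show ?thesis
        using False by (auto simp: wedge_def)
    qed
    from affine_equivalence[OF _ _ this] False that(2) show ?thesis
      by simp
  qed
qed

text \<open>One function for each class.  The sets in the parallel case are subsets of the additive group
  up to affine maps and complement; in the intersecting case they are subsets of the
  multiplicative group up to multiplication and complement.\<close>

definition representatives :: "('f::{field,finite} \<Rightarrow> 'f) list" where
  "representatives =
    [indic {0}, indic {0, 1}, indic {0, 1, 3}, indic {0, 1, 6},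
     wedge {1, 2}, wedge {1, 3}, wedge {1, 2, 3}, wedge {1, 3, 6}]"

text \<open>\<open>f\<close> is equivalent to one of the representatives.\<close>

definition represented :: "('f::{field,finite} \<Rightarrow> 'f) \<Rightarrow> bool" where
  "represented f \<longleftrightarrow> (\<exists>g \<in> set representatives. graph_equiv f g)"

lemma representedI: "g \<in> set representatives \<Longrightarrow> represented g"
proof -
  have "graph_equiv g g"
    by (rule affine_equivalence[where \<alpha> = 1 and \<beta> = 0 and \<gamma> = 1 and \<delta> = 0 and \<epsilon> = 0]) auto
  then show "g \<in> set representatives \<Longrightarrow> represented g"
    unfolding represented_def by blast
qed

lemma represented_cong:
  assumes "graph_equiv f g"
  shows "represented f \<longleftrightarrow> represented g"
  using assms projectively_equivalent_sym projectively_equivalent_trans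
  unfolding represented_def by metis

lemma represented_indic_affine:
  "\<alpha> \<noteq> 0 \<Longrightarrow> represented (indic ((\<lambda>x. \<alpha> * x + \<beta>) ` A)) \<longleftrightarrow> represented (indic A)"
  using represented_cong indic_affine by blast

lemma represented_wedge_scale:
  "\<alpha> \<noteq> 0 \<Longrightarrow> represented (wedge ((*) \<alpha> ` A)) \<longleftrightarrow> represented (wedge A)"
  using represented_cong wedge_scale by blast

context
  assumes card: "CARD('f::{field,finite}) = 7"
begin

lemma represented_indic_small:
  assumes "A \<noteq> {}" "card A \<le> 3"
  shows "represented (indic (A :: 'f set))"
proof -
  note F7 = numeral_mod_7[OF card] residues_7_distinct[OF card]
  have reps: "represented (indic {0 :: 'f})" "represented (indic {0, 1 :: 'f})"
    "represented (indic {0, 1, 3 :: 'f})" "represented (indic {0, 1, 6 :: 'f})"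
    by (rule representedI, simp add: representatives_def)+
  have "card A \<noteq> 0"
    using assms(1) by simp
  with assms(2) consider "card A = 1" | "card A = 2" | "card A = 3"
    by linarith
  then show ?thesis
  proof cases
    case 1
    then obtain a where "A = (\<lambda>x. 1 * x + a) ` {0}"
      by (auto simp: card_1_singleton_iff)
    then show ?thesis
      using represented_indic_affine[of 1 a "{0}"] reps by simp
  next
    case 2
    then obtain a b where ab: "A = {a, b}" "a \<noteq> b"
      by (auto simp: card_2_iff)
    have "A = (\<lambda>x. (b - a) * x + a) ` {0, 1}"
      by (simp add: ab)
    with ab(2) show ?thesis
      using represented_indic_affine[of "b - a" a "{0, 1}"] reps by simp
  next
    case 3
    then obtain a b c where abc: "A = {a, b, c}" "a \<noteq> b" "a \<noteq> c" "b \<noteq> c"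
      by (auto simp: card_3_iff)
    \<comment> \<open>The affine map \<open>x \<mapsto> (b - a) x + a\<close> normalises two of the three elements to 0 and 1.\<close>
    define t where "t = (c - a) / (b - a)"
    have t: "c = (b - a) * t + a" "t \<noteq> 0" "t \<noteq> 1"
      using abc by (auto simp: t_def)
    then have A: "A = (\<lambda>x. (b - a) * x + a) ` {0, 1, t}"
      by (simp add: abc(1))
    have "represented (indic {0, 1, 2 :: 'f})"
    proof -
      have "{0, 1, 2 :: 'f} = (\<lambda>x. 1 * x + 1) ` {0, 1, 6}"
        by (auto simp: F7)
      then show ?thesis
        using represented_indic_affine[of 1 1 "{0, 1, 6 :: 'f}"] reps by simp
    qed
    moreover have "represented (indic {0, 1, 4 :: 'f})"
    proof -
      have "{0, 1, 2 :: 'f} = (\<lambda>x. 2 * x + 0) ` {0, 1, 4}"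
        by (auto simp: F7)
      then show ?thesis
        using represented_indic_affine[of 2 0 "{0, 1, 4 :: 'f}"] calculation F7 by simp
    qed
    moreover have "represented (indic {0, 1, 5 :: 'f})"
    proof -
      have "{0, 1, 3 :: 'f} = (\<lambda>x. 6 * x + 1) ` {0, 1, 5}"
        by (auto simp: F7)
      then show ?thesis
        using represented_indic_affine[of 6 1 "{0, 1, 5 :: 'f}"] reps F7 by simp
    qed
    moreover have "t \<in> {2, 3, 4, 5, 6}"
      using t UNIV_7[OF card] by blast
    ultimately have "represented (indic {0, 1, t})"
      using reps by auto
    with abc(2) show ?thesis
      unfolding A by (subst represented_indic_affine) simp_all
  qed
qed

lemma represented_indic:
  assumes "all_slopes (indic (A :: 'f set))"
  shows "represented (indic A)"
proof -
  have "A \<noteq> {}" "A \<noteq> UNIV"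
    using all_slopes_not_linear[OF assms, of 0 1] all_slopes_not_linear[OF assms, of 0 0]
    by (auto simp: indic_def)
  then have "A \<noteq> {}" "- A \<noteq> {}"
    by auto
  moreover have "card A + card (- A) = 7"
    using card_Un_disjoint[of A "- A"] card by simp
  then have "card A \<le> 3 \<or> card (- A) \<le> 3"
    by linarith
  ultimately show ?thesis
    using represented_indic_small[of A] represented_indic_small[of "- A"]
      represented_cong[OF indic_compl, of A] by blast
qed

text \<open>These two sets are proper nontrivial subgroups of the multiplicative group, and a direction is
  missing: slope 4 and slope 2, respectively.\<close>

lemma no_slope_wedge:
  "\<not> all_slopes (wedge {1, 6 :: 'f})" "\<not> all_slopes (wedge {1, 2, 4 :: 'f})"
proof -
  note F7 = numeral_mod_7[OF card] residues_7_distinct[OF card]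
  define f where "f = wedge {1, 6 :: 'f}"
  have "f 0 = 4 * 0 + 0" "f 2 = 4 * 2 + 1" "f 4 = 4 * 4 + 2" "f 1 = 4 * 1 + 3"
    "f 6 = 4 * 6 + 4" "f 3 = 4 * 3 + 5" "f 5 = 4 * 5 + 6"
    by (simp_all add: f_def wedge_def F7)
  then have "\<exists>x. f x = 4 * x + b" if "b \<in> {0, 1, 2, 3, 4, 5, 6}" for b
    using that by (elim insertE emptyE) blast+
  then have "\<exists>x. f x = 4 * x + b" for b
    using UNIV_7[OF card] by blast
  then show "\<not> all_slopes (wedge {1, 6 :: 'f})"
    unfolding all_slopes_def slope_iff_missed_line f_def by blast
  define g where "g = wedge {1, 2, 4 :: 'f}"
  have "g 0 = 2 * 0 + 0" "g 6 = 2 * 6 + 1" "g 5 = 2 * 5 + 2" "g 2 = 2 * 2 + 3"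
    "g 3 = 2 * 3 + 4" "g 1 = 2 * 1 + 5" "g 4 = 2 * 4 + 6"
    by (simp_all add: g_def wedge_def F7)
  then have "\<exists>x. g x = 2 * x + b" if "b \<in> {0, 1, 2, 3, 4, 5, 6}" for b
    using that by (elim insertE emptyE) blast+
  then have "\<exists>x. g x = 2 * x + b" for b
    using UNIV_7[OF card] by blast
  then show "\<not> all_slopes (wedge {1, 2, 4 :: 'f})"
    unfolding all_slopes_def slope_iff_missed_line g_def by blast
qed

lemma represented_wedge_pair:
  assumes "t \<notin> {0, 1, 6}"
  shows "represented (wedge {1, t :: 'f})"
proof -
  note F7 = numeral_mod_7[OF card] residues_7_distinct[OF card]
  have reps: "represented (wedge {1, 2 :: 'f})" "represented (wedge {1, 3 :: 'f})"
    by (rule representedI, simp add: representatives_def)+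
  have "{1, 2 :: 'f} = (*) 2 ` {1, 4}" "{1, 3 :: 'f} = (*) 3 ` {1, 5}"
    by (auto simp: F7)
  then have "represented (wedge {1, 4 :: 'f})" "represented (wedge {1, 5 :: 'f})"
    using represented_wedge_scale[of 2 "{1, 4 :: 'f}"] represented_wedge_scale[of 3 "{1, 5 :: 'f}"]
      reps F7 by simp_all
  moreover have "t \<in> {2, 3, 4, 5}"
    using assms UNIV_7[OF card] by blast
  ultimately show ?thesis
    using reps by auto
qed

lemma represented_wedge_triple:
  assumes "s \<notin> {0, 1 :: 'f}" "t \<notin> {0, 1}" "s \<noteq> t" "{s, t} \<noteq> {2, 4}"
  shows "represented (wedge {1, s, t :: 'f})"
proof -
  note F7 = numeral_mod_7[OF card] residues_7_distinct[OF card]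
  have reps: "represented (wedge {1, 2, 3 :: 'f})" "represented (wedge {1, 3, 6 :: 'f})"
    by (rule representedI, simp add: representatives_def)+
  have scale: "represented (wedge A)" if "represented (wedge B)" "(*) k ` A = B" "k \<noteq> 0"
    for k :: 'f and A B
    using represented_wedge_scale that by blast
  have compl: "represented (wedge A)" if "represented (wedge B)" "A \<union> B \<union> {0} = UNIV" "A \<inter> B = {}"
    for A B :: "'f set"
  proof -
    have "- A - {0} = B - {0}"
      using that(2,3) by (auto simp: set_eq_iff)
    then have "wedge (- A) = wedge B"
      using wedge_remove_0 by metis
    with that(1) show ?thesis
      using represented_cong[OF wedge_compl] by metis
  qed
  have "represented (wedge {1, 2, 5 :: 'f})"
    by (rule scale[OF reps(2), of 3]) (auto simp: F7)
  moreover have "represented (wedge {1, 3, 5 :: 'f})"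
    by (rule scale[OF reps(1), of 3]) (auto simp: F7)
  moreover have "represented (wedge {1, 4, 5 :: 'f})"
    by (rule scale[OF reps(1), of 2]) (auto simp: F7)
  moreover have "represented (wedge {1, 4, 6 :: 'f})"
    by (rule scale[OF reps(2), of 6]) (auto simp: F7)
  moreover have "represented (wedge {3, 4, 5 :: 'f})"
    by (rule scale[OF reps(2), of 2]) (auto simp: F7)
  then have "represented (wedge {1, 2, 6 :: 'f})"
    by (rule compl) (auto simp: F7 UNIV_7[OF card])
  moreover have "represented (wedge {2, 5, 6 :: 'f})"
    by (rule scale[OF reps(2), of 4]) (auto simp: F7)
  then have "represented (wedge {1, 3, 4 :: 'f})"
    by (rule compl) (auto simp: F7 UNIV_7[OF card])
  moreover have "represented (wedge {2, 3, 4 :: 'f})"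
    by (rule scale[OF reps(2), of 5]) (auto simp: F7)
  then have "represented (wedge {1, 5, 6 :: 'f})"
    by (rule compl) (auto simp: F7 UNIV_7[OF card])
  moreover have "s \<in> {2, 3, 4, 5, 6}" "t \<in> {2, 3, 4, 5, 6}"
    using assms UNIV_7[OF card] by blast+
  ultimately show ?thesis
    using reps assms(3,4) by (elim insertE emptyE) (simp_all add: insert_commute)
qed

lemma represented_wedge_small:
  assumes "all_slopes (wedge A)" "0 \<notin> A" "card A \<le> 3"
  shows "represented (wedge (A :: 'f set))"
proof -
  have slopes: "all_slopes (wedge B)" if "A = (*) a ` B" "a \<noteq> 0" for a B
  proof -
    have "graph_equiv (wedge A) (wedge B)"
      using projectively_equivalent_sym[OF wedge_scale[OF that(2), of B]] that(1) by simp
    then show ?thesis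
      using assms(1) minimal_blocking_set_equivalent graph_set_minimal_blocking
        minimal_blocking_imp_all_slopes by blast
  qed
  have "card A \<noteq> 0"
    using all_slopes_not_linear[OF assms(1), of 1 0] by (auto simp: wedge_def)
  with assms(3) consider "card A = 1" | "card A = 2" | "card A = 3"
    by linarith
  then show ?thesis
  proof cases
    case 1
    then obtain a where a: "A = {a}"
      by (auto simp: card_1_singleton_iff)
    have "represented (indic (- {a}))"
      using represented_indic_small[of "{a}"] represented_cong[OF indic_compl, of "{a}"] by simp
    with a assms(2) show ?thesis
      using represented_cong[OF wedge_singleton, of a] by simp
  next
    case 2
    then obtain a b where ab: "A = {a, b}" "a \<noteq> b"
      by (auto simp: card_2_iff)
    then have nz: "a \<noteq> 0" "b \<noteq> 0"
      using assms(2) by auto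
    then have A: "A = (*) a ` {1, b / a}"
      by (simp add: ab)
    have "b / a \<notin> {0, 1, 6}"
      using slopes[OF A nz(1)] no_slope_wedge(1) ab nz by auto
    then show ?thesis
      unfolding A represented_wedge_scale[OF nz(1)] by (rule represented_wedge_pair)
  next
    case 3
    then obtain a b c where abc: "A = {a, b, c}" "a \<noteq> b" "a \<noteq> c" "b \<noteq> c"
      by (auto simp: card_3_iff)
    then have nz: "a \<noteq> 0" "b \<noteq> 0" "c \<noteq> 0"
      using assms(2) by auto
    then have A: "A = (*) a ` {1, b / a, c / a}"
      by (simp add: abc)
    have "{b / a, c / a} \<noteq> {2, 4}"
      using slopes[OF A nz(1)] no_slope_wedge(2) by auto
    then show ?thesis
      unfolding A represented_wedge_scale[OF nz(1)]
      using abc nz by (intro represented_wedge_triple) auto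
  qed
qed

lemma represented_wedge:
  assumes "all_slopes (wedge (A :: 'f set))"
  shows "represented (wedge A)"
proof -
  define B where "B = A - {0}"
  define C where "C = - A - {0}"
  have B: "wedge B = wedge A" and C: "wedge C = wedge (- A)"
    by (simp_all only: B_def C_def wedge_remove_0)
  have disj: "B \<union> C \<union> {0} = UNIV" "B \<inter> C = {}" "0 \<notin> B \<union> C"
    by (auto simp: B_def C_def)
  then have "card B + card C + 1 = 7"
    using card_Un_disjoint[of B C] card_Un_disjoint[of "B \<union> C" "{0}"] card by simp
  then have "card B \<le> 3 \<or> card C \<le> 3"
    by linarith
  moreover have "all_slopes (wedge C)"
    using assms minimal_blocking_set_equivalent[OF wedge_compl] graph_set_minimal_blocking
      minimal_blocking_imp_all_slopes unfolding C by blast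
  ultimately have "represented (wedge B) \<or> represented (wedge C)"
    using represented_wedge_small[of B] represented_wedge_small[of C] assms disj(3) unfolding B by blast
  then show ?thesis
    using represented_cong[OF wedge_compl] unfolding B C by blast
qed

theorem redei_index3_represented:
  assumes "S \<in> redei_index3"
  obtains g :: "'f \<Rightarrow> 'f" where "g \<in> set representatives" "(S, graph_set g) \<in> projectively_equivalent"
proof -
  obtain f where f: "(S, graph_set f) \<in> projectively_equivalent" "all_slopes f" "two_line_cover f"
    using redei_index3_normal_form[OF card assms] .
  have slopes: "all_slopes g" if "graph_equiv f g" for g
    using f(2) that minimal_blocking_set_equivalent graph_set_minimal_blocking
      minimal_blocking_imp_all_slopes by blast
  have "represented f"
    using f(3,2)
  proof (cases rule: two_line_cover_normal_form)
    case (1 A)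
    then show ?thesis
      using represented_indic slopes represented_cong by blast
  next
    case (2 A)
    then show ?thesis
      using represented_wedge slopes represented_cong by blast
  qed
  with f(1) that show ?thesis
    unfolding represented_def using projectively_equivalent_trans by blast
qed

end

section \<open>An invariant of the three-secants\<close>

text \<open>The intersections of \<open>S\<close> with its three-secants.\<close>

definition three_secants :: "('f::{field,finite} ^ 3) set set \<Rightarrow> ('f ^ 3) set set set" where
  "three_secants S = {S \<inter> L |L. L \<in> pg_lines \<and> card (S \<inter> L) = 3}"

text \<open>Call a point of a set system special if it lies in exactly one member.  The profile
  records the number of members and the size of the union of the members with a special point.\<close>

definition profile :: "'a set set \<Rightarrow> nat \<times> nat" where
  "profile B = (card B, card (\<Union>{t \<in> B. \<exists>p\<in>t. card {u \<in> B. p \<in> u} = 1}))"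

text \<open>The profile depends only on the incidence structure, so it is unchanged by an injection.  This
  serves both for collineations and for the passage from numbers to points.\<close>

lemma profile_image:
  assumes inj: "inj_on p (\<Union>B)"
  shows "profile ((`) p ` B) = profile B"
proof -
  have img: "inj_on ((`) p) B"
    by (rule inj_on_subset[OF inj_on_image_Pow[OF inj]]) auto
  have mem: "p x \<in> p ` u \<longleftrightarrow> x \<in> u" if "x \<in> \<Union>B" "u \<in> B" for x u
    using inj_on_image_mem_iff[OF inj that(1), of u] that(2) by blast
  have deg: "card {u \<in> (`) p ` B. p x \<in> u} = card {u \<in> B. x \<in> u}" if "x \<in> \<Union>B" for x
  proof -
    have "{u \<in> (`) p ` B. p x \<in> u} = (`) p ` {u \<in> B. x \<in> u}"
      using mem[OF that] by auto
    moreover have "inj_on ((`) p) {u \<in> B. x \<in> u}"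
      by (rule inj_on_subset[OF img]) auto
    ultimately show ?thesis
      by (simp add: card_image)
  qed
  define C where "C = {t \<in> B. \<exists>x\<in>t. card {u \<in> B. x \<in> u} = 1}"
  have "(\<exists>q\<in>p ` t. card {u \<in> (`) p ` B. q \<in> u} = 1) \<longleftrightarrow> (\<exists>x\<in>t. card {u \<in> B. x \<in> u} = 1)"
    if "t \<in> B" for t
    unfolding bex_simps(7) using that by (intro bex_cong refl) (simp only: deg[OF UnionI])
  then have C: "{t \<in> (`) p ` B. \<exists>q\<in>t. card {u \<in> (`) p ` B. q \<in> u} = 1} = (`) p ` C"
    unfolding C_def by (intro set_eqI) (simp only: mem_Collect_eq image_iff, blast)
  have "inj_on p (\<Union>C)"
    by (rule inj_on_subset[OF inj]) (auto simp: C_def)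
  then have "card (\<Union>((`) p ` C)) = card (\<Union>C)"
    unfolding image_Union[symmetric] by (rule card_image)
  then show ?thesis
    unfolding profile_def C C_def[symmetric] card_image[OF img] by simp
qed

lemma three_secants_subset: "S \<subseteq> pg_points \<Longrightarrow> \<Union>(three_secants S) \<subseteq> pg_points"
  unfolding three_secants_def by auto

lemma profile_equivalent:
  assumes "(S, T) \<in> projectively_equivalent"
  shows "profile (three_secants T) = profile (three_secants S)"
proof -
  from assms obtain h where h: "collineation h" "S \<subseteq> pg_points" "T \<subseteq> pg_points" "h ` S = T"
    by (rule projectively_equivalentE)
  have eq: "T \<inter> h ` L = h ` (S \<inter> L)" if "L \<in> pg_lines" for L
    using collineation_image_Int[OF h(1,2) pg_line_subset[OF that]] h(4) by simp
  have card: "card (h ` (S \<inter> L)) = card (S \<inter> L)" for L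
    using h(2) by (intro collineation_card_image[OF h(1)]) auto
  have "three_secants T = {T \<inter> L' |L'. L' \<in> (`) h ` pg_lines \<and> card (T \<inter> L') = 3}"
    unfolding three_secants_def collineation_image_lines[OF h(1)] ..
  also have "\<dots> = {T \<inter> h ` L |L. L \<in> pg_lines \<and> card (T \<inter> h ` L) = 3}"
    by auto
  also have "\<dots> = {h ` (S \<inter> L) |L. L \<in> pg_lines \<and> card (S \<inter> L) = 3}"
    using eq card by (intro Collect_cong ex_cong1) (metis (no_types, lifting))
  also have "\<dots> = (`) h ` three_secants S"
    unfolding three_secants_def by auto
  finally have "three_secants T = (`) h ` three_secants S" .
  moreover have "inj_on h (\<Union>(three_secants S))"
    using h(1) three_secants_subset[OF h(2)] by (auto simp: collineation_def bij_betw_def inj_on_subset)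
  ultimately show ?thesis
    by (simp add: profile_image)
qed

section \<open>Computing the invariant modulo seven\<close>

text \<open>A function on the field is encoded by the list of its values at \<open>0, \<dots>, 6\<close>, with values as
  natural numbers.\<close>

definition tabulates :: "nat list \<Rightarrow> ('f::field \<Rightarrow> 'f) \<Rightarrow> bool" where
  "tabulates t f \<longleftrightarrow> (\<forall>k<7. f (of_nat k) = of_nat (t ! k))"

text \<open>The abscissae of the graph points on the line \<open>y = m x + b\<close>.\<close>

definition table_fiber :: "nat list \<Rightarrow> nat \<Rightarrow> nat \<Rightarrow> nat list" where
  "table_fiber t m b = filter (\<lambda>k. t ! k mod 7 = (m * k + b) mod 7) [0..<7]"

text \<open>The three-secants of the graph set.  The number \<open>m < 7\<close> stands for the direction \<open>m\<close> and \<open>7 + k\<close>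
  for the graph point over \<open>k\<close>; vertical lines and the line at infinity are never three-secants.\<close>

definition secant_lists :: "nat list \<Rightarrow> nat list list" where
  "secant_lists t = map (\<lambda>(m, b). m # map ((+) 7) (table_fiber t m b))
     (filter (\<lambda>(m, b). length (table_fiber t m b) = 2) (List.product [0..<7] [0..<7]))"

definition table_profile :: "nat list \<Rightarrow> nat \<times> nat" where
  "table_profile t = profile (set (map set (secant_lists t)))"

text \<open>The table version of \<^const>\<open>all_slopes\<close>, with the subtractions moved to the other side.\<close>

definition table_all_slopes :: "nat list \<Rightarrow> bool" where
  "table_all_slopes t \<longleftrightarrow> (\<forall>m \<in> set [0..<7]. \<exists>k \<in> set [0..<7]. \<exists>l \<in> set [0..<7].
      k \<noteq> l \<and> (t ! k + m * l) mod 7 = (t ! l + m * k) mod 7)"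

context
  assumes card: "CARD('f::{field,finite}) = 7"
begin

lemma tabulates_fiber:
  fixes f :: "'f \<Rightarrow> 'f"
  assumes "tabulates t f"
  shows "{x. f x = of_nat m * x + of_nat b} = of_nat ` {k \<in> {..<7}. t ! k mod 7 = (m * k + b) mod 7}"
proof -
  have "f (of_nat k) = of_nat m * of_nat k + of_nat b \<longleftrightarrow> t ! k mod 7 = (m * k + b) mod 7"
    if "k \<in> {..<7}" for k
  proof -
    have "f (of_nat k) = of_nat (t ! k)"
      using assms that by (simp add: tabulates_def)
    moreover have "of_nat m * of_nat k + of_nat b = (of_nat (m * k + b) :: 'f)"
      by simp
    ultimately show ?thesis
      using of_nat_eq_iff_mod_7[OF card, of "t ! k" "m * k + b"] by (simp only:)
  qed
  moreover have "{x. f x = of_nat m * x + of_nat b} = {x \<in> of_nat ` {..<7}. f x = of_nat m * x + of_nat b}"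
    unfolding UNIV_7_of_nat[OF card, symmetric] by simp
  ultimately show ?thesis
    by (simp add: Compr_image_eq cong: conj_cong)
qed

lemma tabulates_profile:
  fixes f :: "'f \<Rightarrow> 'f"
  assumes f: "tabulates t f"
  shows "profile (three_secants (graph_set f)) = table_profile t"
proof -
  define p where "p k = (if k < 7 then dir (of_nat k) else aff (of_nat (k - 7)) (f (of_nat (k - 7))))" for k
  define K where "K m b = set (table_fiber t m b)" for m b
  define I where "I = {(m, b) \<in> {..<7} \<times> {..<7}. card (K m b) = 2}"
  define J where "J = (\<lambda>(m, b). insert m ((+) 7 ` K m b)) ` I"
  have inj7: "inj_on (of_nat :: nat \<Rightarrow> 'f) {..<7}"
    using of_nat_eq_iff_mod_7[OF card] by (auto simp: inj_on_def)
  have K7: "K m b \<subseteq> {..<7}" for m b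
    by (auto simp: K_def table_fiber_def)
  have fiber: "{x. f x = of_nat m * x + of_nat b} = of_nat ` K m b" for m b
    unfolding tabulates_fiber[OF f] by (rule arg_cong) (auto simp: K_def table_fiber_def)
  have "card (K m b) = length (table_fiber t m b)" for m b
    unfolding K_def by (rule distinct_card) (simp add: table_fiber_def)
  then have "I = set (filter (\<lambda>(m, b). length (table_fiber t m b) = 2) (List.product [0..<7] [0..<7]))"
    by (auto simp: I_def)
  then have J: "J = set ` set (secant_lists t)"
    unfolding J_def secant_lists_def set_map image_image
    by (intro image_cong) (auto simp: K_def)
  have p7: "p (7 + k) = aff (of_nat k) (f (of_nat k))" for k
    by (simp add: p_def)
  have block: "p ` insert m ((+) 7 ` K m b) = graph_set f \<inter> slanted (of_nat m) (of_nat b)" if "m < 7" for m b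
  proof -
    have "p m = dir (of_nat m)"
      using that by (simp add: p_def)
    then show ?thesis
      unfolding graph_set_Int_lines fiber by (simp only: image_insert image_image p7)
  qed
  have size: "card (graph_set f \<inter> slanted (of_nat m) (of_nat b)) = 3 \<longleftrightarrow> card (K m b) = 2" for m b
  proof -
    have "card (of_nat ` K m b :: 'f set) = card (K m b)"
      by (rule card_image, rule inj_on_subset[OF inj7 K7])
    then show ?thesis
      unfolding card_graph_set_Int_lines fiber by simp
  qed
  have "three_secants (graph_set f) = (`) p ` J"
  proof (intro equalityI subsetI)
    fix B assume "B \<in> three_secants (graph_set f)"
    then obtain L where L: "L \<in> pg_lines" "B = graph_set f \<inter> L" "card B = 3"
      unfolding three_secants_def by blast
    from L(1) obtain m b :: 'f where mb: "L = slanted m b"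
    proof (cases rule: pg_line_cases)
      case (2 c)
      then show ?thesis
        using L(2,3) card_graph_set_Int_lines(2)[of f c] by simp
    next
      case 3
      then show ?thesis
        using L(2,3) card_graph_set_Int_lines(3)[of f] card by simp
    qed
    obtain i j where ij: "i < 7" "j < 7" "m = of_nat i" "b = of_nat j"
      using of_nat_7_cases[OF card] by metis
    then have "(i, j) \<in> I"
      using size[of i j] L(2,3) mb by (simp add: I_def)
    moreover have "B = p ` insert i ((+) 7 ` K i j)"
      using block[OF ij(1), of j] L(2) mb ij(3,4) by (simp only:)
    ultimately show "B \<in> (`) p ` J"
      unfolding J_def by (intro image_eqI[of B _ "insert i ((+) 7 ` K i j)"] image_eqI[of _ _ "(i, j)"]) simp_all
  next
    fix B assume "B \<in> (`) p ` J"
    then obtain i j where ij: "(i, j) \<in> I" "B = p ` insert i ((+) 7 ` K i j)"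
      unfolding J_def by auto
    then have "B = graph_set f \<inter> slanted (of_nat i) (of_nat j)"
      using block[of i j] by (simp add: I_def)
    moreover have "card B = 3"
      using size[of i j] ij(1) calculation by (simp add: I_def)
    ultimately show "B \<in> three_secants (graph_set f)"
      unfolding three_secants_def using coordinate_lines_mem(1) by blast
  qed
  moreover have "inj_on p (\<Union>J)"
  proof (rule inj_on_subset)
    show "\<Union>J \<subseteq> {..<14}"
      using K7 by (fastforce simp: J_def I_def)
    show "inj_on p {..<14}"
    proof (rule inj_onI)
      fix k l assume kl: "k \<in> {..<14}" "l \<in> {..<14}" "p k = p l"
      have "(k < 7 \<and> l < 7 \<and> (of_nat k :: 'f) = of_nat l) \<or>
          (\<not> k < 7 \<and> \<not> l < 7 \<and> (of_nat (k - 7) :: 'f) = of_nat (l - 7))"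
        using kl(3) by (auto simp: p_def split: if_splits)
      with kl(1,2) show "k = l"
        unfolding of_nat_eq_iff_mod_7[OF card] by auto
    qed
  qed
  ultimately show ?thesis
    using profile_image[of p J] by (simp add: table_profile_def J)
qed

lemma tabulates_all_slopes:
  fixes f :: "'f \<Rightarrow> 'f"
  assumes f: "tabulates t f" and t: "table_all_slopes t"
  shows "all_slopes f"
  unfolding all_slopes_def
proof
  fix m :: 'f
  obtain i where i: "i < 7" "m = of_nat i"
    by (rule of_nat_7_cases[OF card, of m])
  then have "i \<in> set [0..<7]"
    by simp
  then obtain k l where kl: "k \<in> set [0..<7]" "l \<in> set [0..<7]" "k \<noteq> l"
    "(t ! k + i * l) mod 7 = (t ! l + i * k) mod 7"
    using t unfolding table_all_slopes_def by blast
  then have kl7: "k < 7" "l < 7"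
    by simp_all
  have "(of_nat (t ! k + i * l) :: 'f) = of_nat (t ! l + i * k)"
    unfolding of_nat_eq_iff_mod_7[OF card] by (rule kl(4))
  then have "f (of_nat k) - f (of_nat l) = m * (of_nat k - of_nat l)"
    using f kl7 i(2) by (simp add: tabulates_def algebra_simps)
  moreover have "(of_nat k :: 'f) \<noteq> of_nat l"
    using kl7 kl(3) by (simp add: of_nat_eq_iff_mod_7[OF card])
  ultimately show "\<exists>x x'. x \<noteq> x' \<and> f x - f x' = m * (x - x')"
    by blast
qed

end

text \<open>The value tables of \<^const>\<open>representatives\<close>, in the same order.\<close>

definition tables :: "nat list list" where
  "tables =
    [[0,1,1,1,1,1,1], [0,0,1,1,1,1,1], [0,0,1,0,1,1,1], [0,0,1,1,1,1,0],
     [0,0,0,3,4,5,6], [0,0,2,0,4,5,6], [0,0,0,0,4,5,6], [0,0,2,0,4,5,0]]"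

lemma tables_all_slopes: "list_all table_all_slopes tables"
  by code_simp

lemma tables_profiles:
  "map table_profile tables = [(6, 13), (11, 7), (12, 0), (12, 6), (8, 5), (8, 6), (9, 6), (9, 3)]"
  by code_simp

lemma tables_tabulate:
  assumes card: "CARD('f::{field,finite}) = 7"
  shows "list_all2 tabulates tables (representatives :: ('f \<Rightarrow> 'f) list)"
proof -
  note F7 = residues_7_distinct[OF card]
  have all7: "(\<forall>k<7. P k) \<longleftrightarrow> P 0 \<and> P 1 \<and> P 2 \<and> P 3 \<and> P 4 \<and> P 5 \<and> P 6" for P :: "nat \<Rightarrow> bool"
  proof -
    have "{..<7::nat} = {0, 1, 2, 3, 4, 5, 6}"
      by auto
    moreover have "(\<forall>k<7. P k) \<longleftrightarrow> (\<forall>k\<in>{..<7}. P k)"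
      by (simp only: lessThan_iff Ball_def)
    ultimately show ?thesis
      by (simp only: ball_simps simp_thms)
  qed
  show ?thesis
    unfolding tables_def representatives_def tabulates_def all7
    by (simp add: indic_def wedge_def F7)
qed

lemma representatives_mem:
  assumes card: "CARD('f::{field,finite}) = 7" and g: "(g :: 'f \<Rightarrow> 'f) \<in> set representatives"
  shows "graph_set g \<in> redei_index3"
proof (rule graph_set_mem_redei_index3[OF card])
  obtain i where i: "i < length (representatives :: ('f \<Rightarrow> 'f) list)" "g = representatives ! i"
    using g by (auto simp: in_set_conv_nth)
  with tables_tabulate[OF card] have "i < length tables" "tabulates (tables ! i) g"
    unfolding list_all2_conv_all_nth by simp_all
  with tables_all_slopes show "all_slopes g"
    by (intro tabulates_all_slopes[OF card]) (auto simp: list_all_length)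
  have "two_line_cover (indic A)" "two_line_cover (wedge A)" for A :: "'f set"
    unfolding two_line_cover_def
    by (rule exI[of _ 0], rule exI[of _ 0], rule exI[of _ 0], rule exI[of _ 1], simp add: indic_def)
      (rule exI[of _ 0], rule exI[of _ 0], rule exI[of _ 1], rule exI[of _ 0], simp add: wedge_def)
  then show "two_line_cover g"
    using g by (auto simp: representatives_def)
qed

lemma representatives_profiles:
  assumes card: "CARD('f::{field,finite}) = 7"
  shows "map (\<lambda>g :: 'f \<Rightarrow> 'f. profile (three_secants (graph_set g))) representatives
    = [(6, 13), (11, 7), (12, 0), (12, 6), (8, 5), (8, 6), (9, 6), (9, 3)]"
proof -
  have "map (\<lambda>g :: 'f \<Rightarrow> 'f. profile (three_secants (graph_set g))) representatives
      = map table_profile tables"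
    using tables_tabulate[OF card] tabulates_profile[OF card]
    by (auto simp: list_all2_conv_all_nth intro!: nth_equalityI)
  then show ?thesis
    by (simp only: tables_profiles)
qed

section \<open>The classification\<close>

theorem mainTheorem5:
  assumes "CARD('f::{field,finite}) = 7"
  shows "card ({S :: ('f ^ 3) set set.
            redei_blocking_set S \<and> blocking_index S = 3 \<and> card S = 14}
          // projectively_equivalent) = 8"
proof -
  define R where "R = set (representatives :: ('f \<Rightarrow> 'f) list)"
  define cls where "cls g = projectively_equivalent `` {graph_set g}" for g :: "'f \<Rightarrow> 'f"
  have distinct: "distinct (map (\<lambda>g :: 'f \<Rightarrow> 'f. profile (three_secants (graph_set g))) representatives)"
    unfolding representatives_profiles[OF assms] by simp
  then have inj: "inj_on (\<lambda>g. profile (three_secants (graph_set g))) R"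
    and "card R = length (representatives :: ('f \<Rightarrow> 'f) list)"
    unfolding R_def distinct_map by (auto simp: distinct_card)
  then have "card R = 8"
    by (simp add: representatives_def)
  have "inj_on cls R"
  proof (rule inj_onI)
    fix g g' assume g: "g \<in> R" "g' \<in> R" "cls g = cls g'"
    have "graph_equiv g g'"
      using eq_equiv_class[OF g(3)[unfolded cls_def] equiv_projectively_equivalent] graph_set_subset by blast
    then show "g = g'"
      using inj g(1,2) profile_equivalent by (metis inj_on_def)
  qed
  have "(redei_index3 :: ('f ^ 3) set set set) // projectively_equivalent = cls ` R"
  proof (intro equalityI subsetI)
    fix c :: "('f ^ 3) set set set"
    assume "c \<in> redei_index3 // projectively_equivalent"
    then obtain S where S: "S \<in> redei_index3" "c = projectively_equivalent `` {S}"
      by (rule quotientE) blast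
    obtain g where "g \<in> set representatives" "(S, graph_set g) \<in> projectively_equivalent"
      using redei_index3_represented[OF assms S(1)] .
    then have "g \<in> R" "c = cls g"
      unfolding R_def cls_def S(2) using equiv_class_eq[OF equiv_projectively_equivalent] by blast+
    then show "c \<in> cls ` R"
      by blast
  next
    fix c assume "c \<in> cls ` R"
    then show "c \<in> redei_index3 // projectively_equivalent"
      unfolding R_def cls_def using representatives_mem[OF assms] by (auto intro: quotientI)
  qed
  then have "card ((redei_index3 :: ('f ^ 3) set set set) // projectively_equivalent) = 8"
    using card_image[OF \<open>inj_on cls R\<close>] \<open>card R = 8\<close> by simp
  then show ?thesis
    unfolding redei_index3_def .
qed

end
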